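(* Let $\alpha_1,\dots,\alpha_n$ be distinct nonzero elements of $\mathbb{F}_q$, let $v_1,\dots,v_n\in\mathbb{F}_q^*$, let $t\ge2$ be even with $0\le n-t\le n$, let $0\le l\le n-t-1$, and let $\eta_1,\lambda_1\in\mathbb{F}_q$ be not both zero. Let $C=\mathrm{TGRS}_{n-t,n-t}(\boldsymbol\alpha,\boldsymbol v,l,\eta_1,\lambda_1)$ (see context) be an MDS $[n,n-t,t+1]$ code, with parity-check matrix $H$ and associated $w_1,\dots,w_n$, $f(x)$ as given in the context. Let $\boldsymbol r\in\mathbb{F}_q^n$ be a received word with $d(\boldsymbol r,C)\le\frac t2$, with error word $\boldsymbol e$ and error location set $J_{\boldsymbol e}=\{j: e_j\ne0\}$; let $(s_0,\dots,s_{t-1})^T=H\boldsymbol r^T$, let $S(x)=\sum_{i=0}^{t-1}s_{t-1-i}x^i$ be the syndrome polynomial of $\boldsymbol r$, and let $g(x)=x^t$. Let $\sigma_i(x),\tau_i(x)$, $i\in\{-1,0,\dots,v+1\}$, be the polynomials from the extended Euclid's Algorithm applied to $g(x)$ and $S(x)$ (see context). Let $h$ be the minimum index such that $\deg\tau_h(x)<\frac t2$. (1) If $\deg\sigma_h(x)<\frac t2$, then $(\sigma,\tau)=(\sigma_h,\tau_h)$ satisfies $$S(x)\sigma(x)\equiv\tau(x)\pmod{x^t},\qquad\gcd(\sigma(x),\tau(x))=1,\qquad\deg\tau(x)\le\deg\sigma(x)=|J_{\boldsymbol e}|\le\tfrac t2, \qquad ( * )$$ and $d(\boldsymbol r,C)<\frac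 t2$. (2) If $\deg\sigma_h(x)=\frac t2$, then there exists $\lambda\in\mathbb{F}_q$ such that $(\sigma,\tau)=(\lambda\sigma_{h-1}+\sigma_h,\ \lambda\tau_{h-1}+\tau_h)$ satisfies $( * )$ as well as the following condition $( ** )$: with $J=\{i:\sigma(\alpha_i)=0,\ 1\le i\le n\}$ one has $\deg\sigma=|J|$, and, defining $$\epsilon_i=-\frac{\tau(\alpha_i)}{w_i\alpha_i^t\sigma'(\alpha_i)}\ (i\in J),\qquad \epsilon_i=0\ (i\notin J),$$ one has $\tau(x)=a\sigma(x)+\omega(x)$ with $a=\sum_{j\in J}\epsilon_jw_jf(\alpha_j)$, $\omega(x)=-\sum_{j\in J}\epsilon_jw_j\alpha_j^t\frac{\sigma(x)}{x-\alpha_j}$ and $\deg \omega(x)<|J|$. Furthermore $d(\boldsymbol r,C)=\frac t2$, and $\lambda$ is one of the most frequent elements in $\mathcal B=\{\beta_i\mid1\le i\le n\}\setminus\{\infty\}$, where $$\beta_i=\begin{cases}\sigma_{h-1}(\alpha_i)^{-1}\sigma_h(\alpha_i),&\text{if }\sigma_{h-1}(\alpha_i)\ne0,\\ \infty,&\text{if }\sigma_{h-1}(\alpha_i)=0.\end{cases}$$ Moreover, Algorithm B (given in the context) can be used to locate the error word $\boldsymbol e$.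
   Context: $\mathbb{F}_q$ is the finite field with $q$ elements; $\deg0=-\infty$; $\sigma'$ is the formal derivative of $\sigma$. For $\boldsymbol\alpha=(\alpha_1,\dots,\alpha_n)$, $\boldsymbol v=(v_1,\dots,v_n)$, the code $\mathrm{TGRS}_{n-t,n-t}(\boldsymbol\alpha,\boldsymbol v,l,\eta_1,\lambda_1)$ is the $\mathbb{F}_q$-span of the vectors $(v_1\alpha_1^j,\dots,v_n\alpha_n^j)$ for $0\le j\le n-t-1$, $j\ne l$, together with $\big(v_1(\lambda_1\alpha_1^l+\eta_1\alpha_1^{n-t}),\dots,v_n(\lambda_1\alpha_n^l+\eta_1\alpha_n^{n-t})\big)$. Parity-check matrix $H$: put $u_i^{-1}=\prod_{j\ne i}(\alpha_i-\alpha_j)$, $w_i=u_i/v_i$, and $P_k=\sum_{i=1}^n u_i\alpha_i^k$ (one has $P_{n-1}\ne0$). If $\eta_1\ne0$, let $f(x)=x^{n-l-1}+a_{n-l-2}x^{n-l-2}+\cdots+a_tx^t+a_{t-1}x^{t-1}$ with $a_{n-l-1}=1$, $a_{n-l-2-r}=-\frac{1}{P_{n-1}}\sum_{j=0}^r a_{n-l-1-j}P_{n+r-j}$ for $0\le r\le n-t-l-2$, and $a_{t-1}=-\frac{1}{\eta_1P_{n-1}}\Big(\eta_1\sum_{j=0}^{n-t-l-1}a_{n-l-1-j}P_{2n-t-l-1-j}+\lambda_1P_{n-1}\Big)-1$; if $\eta_1=0$ (then $C$ is a generalized Reed-Solomon code), let $f=0$. $H$ is the $t\times n$ matrix with rows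 $(w_1\alpha_1^i,\dots,w_n\alpha_n^i)$ for $0\le i\le t-2$ and last row $\big(w_1(\alpha_1^{t-1}+f(\alpha_1)),\dots,w_n(\alpha_n^{t-1}+f(\alpha_n))\big)$. $d(\boldsymbol r,C)$ is the minimum Hamming distance from $\boldsymbol r$ to $C$. The received word is $\boldsymbol r=\boldsymbol c+\boldsymbol e$ with $\boldsymbol c\in C$ and error word $\boldsymbol e$ having at most $\frac t2$ nonzero entries. $\mathcal B$ is regarded as a list with repetitions: the frequency of $\beta\in\mathbb{F}_q$ is $|\{i:\beta_i=\beta\}|$, and a most frequent element is one of maximal frequency. Extended Euclid's Algorithm applied to $g\ne0$ and $S$ with $\deg g>\deg S$: set $\sigma_{-1}=0$, $\tau_{-1}=g$, $\sigma_0=1$, $\tau_0=S$; for $i\ge1$, as long as $\tau_{i-1}\ne0$, divide $\tau_{i-2}=q_i\tau_{i-1}+\tau_i$ with $\deg\tau_i<\deg\tau_{i-1}$ and set $\sigma_i=\sigma_{i-2}-q_i\sigma_{i-1}$; $v$ is the largest index with $\tau_v\ne0$ (so $\tau_{v+1}=0$). Algorithm B. Input $\boldsymbol r\in\mathbb{F}_q^n$; output $\boldsymbol c\in\mathbb{F}_q^n$. Step 1: compute $(s_0,\dots,s_{t-1})^T=H\boldsymbol r^T$ and $S(x)=\sum_{i=0}^{t-1}s_{t-1-i}x^i$. Step 2: set $\tau_{-1}=g=x^t$, $\tau_0=S$, $\sigma_{-1}=0$, $\sigma_0=1$, $k=-2$. Step 3: repeat { replace $k$ by $k+1$; let $q_{k+2}$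 and $\tau_{k+2}$ be the quotient and remainder of $\tau_k$ divided by $\tau_{k+1}$; set $\sigma_{k+2}=\sigma_k-q_{k+2}\sigma_{k+1}$ } until $\deg\tau_{k+2}(x)<\frac t2$. Step 4: if $\deg\sigma_{k+2}<\frac t2$, set $\sigma=\sigma_{k+2}$, $\tau=\tau_{k+2}$, and for $i=1,\dots,n$ set $e_i=-\frac{\tau(\alpha_i)}{w_i\alpha_i^t\sigma'(\alpha_i)}$ if $\sigma(\alpha_i)=0$ and $e_i=0$ otherwise. Step 5: else, for $i=1,\dots,n$ set $\beta_i=\sigma_{k+1}(\alpha_i)^{-1}\sigma_{k+2}(\alpha_i)$ if $\sigma_{k+1}(\alpha_i)\ne0$ and $\beta_i=\infty$ otherwise; then, for each most frequent element $\lambda$ of the list $\{\beta_i\}$ with $\infty$ excluded, set $\sigma=\lambda\sigma_{k+1}+\sigma_{k+2}$, $\tau=\lambda\tau_{k+1}+\tau_{k+2}$, compute $e_1,\dots,e_n$ by the formula of Step 4, and, with $J=\{i:\sigma(\alpha_i)=0\}$, stop the loop over $\lambda$ if $\tau(x)=a\sigma(x)+\omega(x)$ holds with $a=\sum_{j\in J}e_jw_jf(\alpha_j)$ and $\omega(x)=-\sum_{j\in J}e_jw_j\alpha_j^t\frac{\sigma(x)}{x-\alpha_j}$. Step 6: output $\boldsymbol e=(e_1,\dots,e_n)$ and $\boldsymbol c=\boldsymbol r-\boldsymbol e$.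
   Formalization: The formal version takes β_i = −σ_{h−1}(α_i)^{-1}σ_h(α_i), in part (2) and in Algorithm B: without the minus sign the claim fails in odd characteristic. For S = 0, division by the zero polynomial in Algorithm B is read as quotient 0, remainder the dividend. *)

theory Defs
  imports
    "HOL-Analysis.Cartesian_Space"
    "HOL-Computational_Algebra.Polynomial"
    "HOL-Number_Theory.Cong"
    "HOL-Library.While_Combinator"
begin

text \<open>
  The field \<open>\<bbbF>\<^sub>q\<close> is a type \<open>'a\<close> of sort \<open>{field, finite}\<close>. Words of length \<open>n\<close> are
  elements of \<open>'a ^ 'n\<close> with \<open>n = CARD('n)\<close>, so the positions \<open>1, \<dots>, n\<close> are the elements of
  \<open>'n\<close>. All polynomials have degree \<open>-\<infinity>\<close> at \<open>0\<close> in the mathematics and \<open>degree 0 = 0\<close> here;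
  each comparison below where this matters treats the zero polynomial separately, the others
  compare with a bound that is positive for \<open>t \<ge> 2\<close>.
\<close>

section \<open>Codes\<close>

definition hamming_dist :: "'a ^ 'n \<Rightarrow> 'a ^ 'n \<Rightarrow> nat" where
  "hamming_dist x y = card {i. x $ i \<noteq> y $ i}"

definition support :: "('a::zero) ^ 'n \<Rightarrow> 'n set" where
  "support x = {i. x $ i \<noteq> 0}"

definition dist_to_code :: "'a ^ 'n \<Rightarrow> ('a ^ 'n) set \<Rightarrow> nat" where
  "dist_to_code r C = (INF c\<in>C. hamming_dist r c)"

definition min_distance :: "('a ^ 'n) set \<Rightarrow> nat" where
  "min_distance C = Inf {hamming_dist x y | x y. x \<in> C \<and> y \<in> C \<and> x \<noteq> y}"

definition linear_code :: "(('a::field) ^ 'n) set \<Rightarrow> nat \<Rightarrow> nat \<Rightarrow> bool" where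
  "linear_code C k d \<longleftrightarrow> vec.subspace C \<and> vec.dim C = k \<and> min_distance C = d"

definition MDS_code :: "(('a::field) ^ 'n) set \<Rightarrow> nat \<Rightarrow> nat \<Rightarrow> bool" where
  "MDS_code C k d \<longleftrightarrow> linear_code C k d \<and> d + k = CARD('n) + 1"

text \<open>\<open>TGRS k \<alpha> v l \<eta> lam\<close> is \<open>TGRS\<^bsub>k,k\<^esub>(\<alpha>, v, l, \<eta>, lam)\<close>.\<close>

definition TGRS :: "nat \<Rightarrow> ('a::field) ^ 'n \<Rightarrow> 'a ^ 'n \<Rightarrow> nat \<Rightarrow> 'a \<Rightarrow> 'a \<Rightarrow> ('a ^ 'n) set" where
  "TGRS k \<alpha> v l \<eta> lam = vec.span
     (insert (\<chi> i. v $ i * (lam * (\<alpha> $ i) ^ l + \<eta> * (\<alpha> $ i) ^ k))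
        {(\<chi> i. v $ i * (\<alpha> $ i) ^ j) | j. j < k \<and> j \<noteq> l})"

section \<open>The parity-check matrix\<close>

definition u_vec :: "('a::field) ^ 'n \<Rightarrow> 'a ^ 'n" where
  "u_vec \<alpha> = (\<chi> i. inverse (\<Prod>j\<in>UNIV - {i}. \<alpha> $ i - \<alpha> $ j))"

definition w_vec :: "('a::field) ^ 'n \<Rightarrow> 'a ^ 'n \<Rightarrow> 'a ^ 'n" where
  "w_vec \<alpha> v = (\<chi> i. u_vec \<alpha> $ i / v $ i)"

definition power_sum :: "('a::field) ^ 'n \<Rightarrow> nat \<Rightarrow> 'a" where
  "power_sum \<alpha> k = (\<Sum>i\<in>UNIV. u_vec \<alpha> $ i * (\<alpha> $ i) ^ k)"

text \<open>\<open>f_top \<alpha> r\<close> is the coefficient \<open>a\<^bsub>n-l-1-r\<^esub>\<close> of \<open>f\<close>, for \<open>0 \<le> r \<le> n-t-l-1\<close>: counted from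
  the top, the coefficients satisfy a recursion that does not involve \<open>l\<close>.\<close>

fun f_top :: "('a::field) ^ 'n \<Rightarrow> nat \<Rightarrow> 'a" where
  "f_top \<alpha> 0 = 1"
| "f_top \<alpha> (Suc r) =
     - (1 / power_sum \<alpha> (CARD('n) - 1)) * (\<Sum>j\<le>r. f_top \<alpha> j * power_sum \<alpha> (CARD('n) + r - j))"

text \<open>The coefficient \<open>a\<^bsub>t-1\<^esub>\<close> of \<open>f\<close> for \<open>\<eta> \<noteq> 0\<close>.\<close>

definition f_low :: "nat \<Rightarrow> ('a::field) ^ 'n \<Rightarrow> nat \<Rightarrow> 'a \<Rightarrow> 'a \<Rightarrow> 'a" where
  "f_low t \<alpha> l \<eta> lam = (let n = CARD('n) in
     - (1 / (\<eta> * power_sum \<alpha> (n - 1))) *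
         (\<eta> * (\<Sum>j\<le>n - t - l - 1. f_top \<alpha> j * power_sum \<alpha> (2 * n - t - l - 1 - j))
          + lam * power_sum \<alpha> (n - 1)) - 1)"

definition f_poly :: "nat \<Rightarrow> ('a::field) ^ 'n \<Rightarrow> nat \<Rightarrow> 'a \<Rightarrow> 'a \<Rightarrow> 'a poly" where
  "f_poly t \<alpha> l \<eta> lam = (let n = CARD('n) in
     if \<eta> = 0 then 0
     else (\<Sum>m = t..n - l - 1. monom (f_top \<alpha> (n - l - 1 - m)) m)
          + monom (f_low t \<alpha> l \<eta> lam) (t - 1))"

text \<open>The \<open>t \<times> n\<close> matrix \<open>H\<close>, given by its rows \<open>0, \<dots>, t-1\<close>.\<close>

definition parity_check :: "nat \<Rightarrow> ('a::field) ^ 'n \<Rightarrow> 'a ^ 'n \<Rightarrow> 'a poly \<Rightarrow> nat \<Rightarrow> 'a ^ 'n" where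
  "parity_check t \<alpha> w f k =
     (if k = t - 1 then (\<chi> i. w $ i * ((\<alpha> $ i) ^ (t - 1) + poly f (\<alpha> $ i)))
      else (\<chi> i. w $ i * (\<alpha> $ i) ^ k))"

definition syndrome :: "(nat \<Rightarrow> ('a::field) ^ 'n) \<Rightarrow> 'a ^ 'n \<Rightarrow> nat \<Rightarrow> 'a" where
  "syndrome H r k = (\<Sum>i\<in>UNIV. H k $ i * r $ i)"

definition syndrome_poly :: "nat \<Rightarrow> (nat \<Rightarrow> 'a) \<Rightarrow> ('a::field) poly" where
  "syndrome_poly t s = (\<Sum>i<t. monom (s (t - 1 - i)) i)"

section \<open>The Extended Euclidean Algorithm\<close>

text \<open>\<open>\<sigma>\<close> and \<open>\<tau>\<close> are constrained only at the indices \<open>-1, \<dots>, m + 1\<close>, where \<open>m\<close> is the largest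
  index with nonzero remainder.\<close>

definition extended_euclid ::
  "('a::field) poly \<Rightarrow> 'a poly \<Rightarrow> (int \<Rightarrow> 'a poly) \<Rightarrow> (int \<Rightarrow> 'a poly) \<Rightarrow> int \<Rightarrow> bool" where
  "extended_euclid g S \<sigma> \<tau> m \<longleftrightarrow>
     \<sigma> (-1) = 0 \<and> \<tau> (-1) = g \<and> \<sigma> 0 = 1 \<and> \<tau> 0 = S \<and>
     (\<forall>i\<in>{1..m+1}. \<tau> i = \<tau> (i - 2) mod \<tau> (i - 1) \<and>
                    \<sigma> i = \<sigma> (i - 2) - (\<tau> (i - 2) div \<tau> (i - 1)) * \<sigma> (i - 1)) \<and>
     -1 \<le> m \<and> (\<forall>i\<in>{-1..m}. \<tau> i \<noteq> 0) \<and> \<tau> (m + 1) = 0"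

section \<open>Error locators and error values\<close>

definition key_equation ::
  "nat \<Rightarrow> ('a::field) poly \<Rightarrow> 'n set \<Rightarrow> 'a poly \<Rightarrow> 'a poly \<Rightarrow> bool" where
  "key_equation t S J \<sigma> \<tau> \<longleftrightarrow>
     [S * \<sigma> = \<tau>] (mod monom 1 t) \<and> coprime \<sigma> \<tau> \<and>
     degree \<tau> \<le> degree \<sigma> \<and> degree \<sigma> = card J \<and> card J \<le> t div 2"

definition root_set :: "('a::field) ^ 'n \<Rightarrow> 'a poly \<Rightarrow> 'n set" where
  "root_set \<alpha> \<sigma> = {i. poly \<sigma> (\<alpha> $ i) = 0}"

definition error_values ::
  "nat \<Rightarrow> ('a::field) ^ 'n \<Rightarrow> 'a ^ 'n \<Rightarrow> 'a poly \<Rightarrow> 'a poly \<Rightarrow> 'a ^ 'n" where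
  "error_values t \<alpha> w \<sigma> \<tau> =
     (\<chi> i. if i \<in> root_set \<alpha> \<sigma>
           then - (poly \<tau> (\<alpha> $ i) / (w $ i * (\<alpha> $ i) ^ t * poly (pderiv \<sigma>) (\<alpha> $ i)))
           else 0)"

definition a_coeff :: "('a::field) ^ 'n \<Rightarrow> 'a ^ 'n \<Rightarrow> 'a poly \<Rightarrow> 'a poly \<Rightarrow> 'a ^ 'n \<Rightarrow> 'a" where
  "a_coeff \<alpha> w f \<sigma> \<epsilon> = (\<Sum>j\<in>root_set \<alpha> \<sigma>. \<epsilon> $ j * w $ j * poly f (\<alpha> $ j))"

text \<open>The division by \<open>[:- \<alpha> $ j, 1:]\<close>, i.e. by \<open>x - \<alpha>\<^sub>j\<close>, is exact.\<close>

definition omega_poly ::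
  "nat \<Rightarrow> ('a::field) ^ 'n \<Rightarrow> 'a ^ 'n \<Rightarrow> 'a poly \<Rightarrow> 'a ^ 'n \<Rightarrow> 'a poly" where
  "omega_poly t \<alpha> w \<sigma> \<epsilon> =
     - (\<Sum>j\<in>root_set \<alpha> \<sigma>. smult (\<epsilon> $ j * w $ j * (\<alpha> $ j) ^ t) (\<sigma> div [:- \<alpha> $ j, 1:]))"

definition tau_decomposition ::
  "nat \<Rightarrow> ('a::field) ^ 'n \<Rightarrow> 'a ^ 'n \<Rightarrow> 'a poly \<Rightarrow> 'a poly \<Rightarrow> 'a poly \<Rightarrow> bool" where
  "tau_decomposition t \<alpha> w f \<sigma> \<tau> \<longleftrightarrow> (let \<epsilon> = error_values t \<alpha> w \<sigma> \<tau> in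
     \<tau> = smult (a_coeff \<alpha> w f \<sigma> \<epsilon>) \<sigma> + omega_poly t \<alpha> w \<sigma> \<epsilon>)"

definition locator_condition ::
  "nat \<Rightarrow> ('a::field) ^ 'n \<Rightarrow> 'a ^ 'n \<Rightarrow> 'a poly \<Rightarrow> 'a poly \<Rightarrow> 'a poly \<Rightarrow> bool" where
  "locator_condition t \<alpha> w f \<sigma> \<tau> \<longleftrightarrow>
     (let J = root_set \<alpha> \<sigma>; \<omega> = omega_poly t \<alpha> w \<sigma> (error_values t \<alpha> w \<sigma> \<tau>) in
       degree \<sigma> = card J \<and> tau_decomposition t \<alpha> w f \<sigma> \<tau> \<and> (\<omega> = 0 \<or> degree \<omega> < card J))"

text \<open>
  \<open>beta \<alpha> \<sigma>' \<sigma> i\<close> is \<open>None\<close> for \<open>\<infinity>\<close>. The sign is essential: \<open>lam * \<sigma>' + \<sigma>\<close> vanishes at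
  \<open>\<alpha>\<^sub>i\<close> with \<open>\<sigma>'(\<alpha>\<^sub>i) \<noteq> 0\<close> iff \<open>lam = - \<sigma>'(\<alpha>\<^sub>i)\<^sup>-\<^sup>1 \<sigma>(\<alpha>\<^sub>i)\<close>. The source omits the minus sign,
  which is correct in characteristic \<open>2\<close> only: over \<open>\<bbbF>\<^sub>5\<close> with \<open>\<alpha> = (2,3,4)\<close>, \<open>v = (3,4,3)\<close>,
  \<open>t = 2\<close>, \<open>l = 0\<close>, \<open>\<eta> = 3\<close>, \<open>lam = 0\<close> and \<open>e = (0,4,0)\<close>, no most frequent element of the
  list without the sign gives the error locator.
\<close>

definition beta :: "('a::field) ^ 'n \<Rightarrow> 'a poly \<Rightarrow> 'a poly \<Rightarrow> 'n \<Rightarrow> 'a option" where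
  "beta \<alpha> \<sigma>' \<sigma> i =
     (if poly \<sigma>' (\<alpha> $ i) \<noteq> 0 then Some (- (inverse (poly \<sigma>' (\<alpha> $ i)) * poly \<sigma> (\<alpha> $ i)))
      else None)"

definition frequency :: "('n \<Rightarrow> 'a option) \<Rightarrow> 'a \<Rightarrow> nat" where
  "frequency \<beta> x = card {i. \<beta> i = Some x}"

definition most_frequent :: "('n \<Rightarrow> 'a option) \<Rightarrow> 'a set" where
  "most_frequent \<beta> = {x. Some x \<in> range \<beta> \<and> (\<forall>y. frequency \<beta> y \<le> frequency \<beta> x)}"

section \<open>Algorithm B\<close>

text \<open>
  The state of the loop in Step 3 is \<open>(\<sigma>\<^bsub>k+1\<^esub>, \<tau>\<^bsub>k+1\<^esub>, \<sigma>\<^bsub>k+2\<^esub>, \<tau>\<^bsub>k+2\<^esub>)\<close>; the body is executed at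
  least once. For \<open>S = 0\<close> its first division is by the zero polynomial and is understood by
  \<open>p div 0 = 0\<close> and \<open>p mod 0 = p\<close>; the loop then ends with \<open>\<sigma> = 1\<close> and \<open>\<tau> = 0\<close>.
\<close>

type_synonym 'a euclid_state = "'a poly \<times> 'a poly \<times> 'a poly \<times> 'a poly"

definition euclid_step :: "('a::field) euclid_state \<Rightarrow> 'a euclid_state" where
  "euclid_step = (\<lambda>(\<sigma>', \<tau>', \<sigma>, \<tau>). (\<sigma>, \<tau>, \<sigma>' - (\<tau>' div \<tau>) * \<sigma>, \<tau>' mod \<tau>))"

definition euclid_loop :: "nat \<Rightarrow> ('a::field) poly \<Rightarrow> 'a euclid_state option" where
  "euclid_loop t S =
     while_option (\<lambda>(\<sigma>', \<tau>', \<sigma>, \<tau>). \<not> degree \<tau> < t div 2) euclid_step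
       (euclid_step (0, monom 1 t, 1, S))"

text \<open>The loop of Step 5: \<open>prev\<close> is the error word computed in the previous round, if any.\<close>

primrec try_all ::
  "('c \<Rightarrow> 'e) \<Rightarrow> ('c \<Rightarrow> bool) \<Rightarrow> 'c list \<Rightarrow> 'e option \<Rightarrow> 'e option" where
  "try_all err stop [] prev = prev"
| "try_all err stop (x # xs) prev =
     (if stop x then Some (err x) else try_all err stop xs (Some (err x)))"

text \<open>
  Step 5 does not prescribe the order in which the most frequent elements are tried;
  \<open>enum\<close> is the enumeration that is used. The result is the pair \<open>(e, c)\<close>, and \<open>None\<close> if
  there is no output (because a loop does not terminate or no error word is computed).
\<close>

definition algorithm_B ::
  "('a set \<Rightarrow> 'a list) \<Rightarrow> nat \<Rightarrow> ('a::field) ^ 'n \<Rightarrow> 'a ^ 'n \<Rightarrow> 'a poly \<Rightarrow> (nat \<Rightarrow> 'a ^ 'n) \<Rightarrow>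
     'a ^ 'n \<Rightarrow> (('a ^ 'n) \<times> ('a ^ 'n)) option" where
  "algorithm_B enum t \<alpha> w f H r =
     (case euclid_loop t (syndrome_poly t (syndrome H r)) of
        None \<Rightarrow> None
      | Some (\<sigma>', \<tau>', \<sigma>, \<tau>) \<Rightarrow>
          map_option (\<lambda>e. (e, r - e))
            (if degree \<sigma> < t div 2 then Some (error_values t \<alpha> w \<sigma> \<tau>)
             else try_all
                    (\<lambda>lam. error_values t \<alpha> w (smult lam \<sigma>' + \<sigma>) (smult lam \<tau>' + \<tau>))
                    (\<lambda>lam. tau_decomposition t \<alpha> w f (smult lam \<sigma>' + \<sigma>) (smult lam \<tau>' + \<tau>))
                    (enum (most_frequent (beta \<alpha> \<sigma>' \<sigma>))) None))"

end

theory Submission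
  imports Defs
begin

text \<open>
  Divided differences over the points \<open>\<alpha>\<^sub>i\<close> read off the coefficient of \<open>x^(n-1)\<close>; hence the
  kernel of \<open>H\<close> consists of the words \<open>(v\<^sub>i p(\<alpha>\<^sub>i))\<close> with \<open>p\<close> spanned by the twisted monomials,
  and so it is \<open>C\<close>. For an error word \<open>e\<close> with locator \<open>\<sigma>\<close>, the syndrome polynomial satisfies
  \<open>S \<sigma> \<equiv> a \<sigma> + \<omega>\<close> modulo \<open>x^t\<close>. Consecutive rows \<open>(\<sigma>\<^sub>i, \<tau>\<^sub>i)\<close> of the Euclidean algorithm form
  a basis of the solution module of this congruence, and degrees bound the coordinates of the
  true locator in the basis at the index \<open>h\<close>: it is a multiple of row \<open>h\<close>, or, if
  \<open>deg \<sigma>\<^sub>h = t/2\<close>, a combination of rows \<open>h - 1\<close> and \<open>h\<close> with constant coefficients. The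
  frequency of \<open>\<lambda>\<close> is the number of roots of \<open>\<lambda> \<sigma>\<^bsub>h-1\<^esub> + \<sigma>\<^sub>h\<close> among the \<open>\<alpha>\<^sub>i\<close>, which is at most
  \<open>t/2\<close> and attained by the locator. A candidate that passes the test of Step 5 produces a word
  of weight at most \<open>t/2\<close> with syndrome \<open>S\<close>, and by the minimum distance of \<open>C\<close> this word is \<open>e\<close>.
\<close>

section \<open>Divided differences and interpolation\<close>

text \<open>The Newton divided difference over all n points in symmetric form. Syndromes are values
  of this linear functional, and on degrees below n it reads off one coefficient.\<close>

definition divided_difference :: "('a::field) ^ 'n \<Rightarrow> 'a poly \<Rightarrow> 'a" where
  "divided_difference \<alpha> p = (\<Sum>i\<in>UNIV. u_vec \<alpha> $ i * poly p (\<alpha> $ i))"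

lemma divided_difference_0 [simp]: "divided_difference \<alpha> 0 = 0"
  by (simp add: divided_difference_def)

lemma divided_difference_add:
  "divided_difference \<alpha> (p + q) = divided_difference \<alpha> p + divided_difference \<alpha> q"
  by (simp add: divided_difference_def algebra_simps sum.distrib)

lemma divided_difference_smult: "divided_difference \<alpha> (smult c p) = c * divided_difference \<alpha> p"
  by (simp add: divided_difference_def sum_distrib_left algebra_simps)

lemma divided_difference_sum:
  "divided_difference \<alpha> (\<Sum>x\<in>A. f x) = (\<Sum>x\<in>A. divided_difference \<alpha> (f x))"
  by (induction A rule: infinite_finite_induct) (auto simp: divided_difference_add)

lemma divided_difference_monom: "divided_difference \<alpha> (monom c k) = c * power_sum \<alpha> k"
  by (simp add: divided_difference_def power_sum_def poly_monom sum_distrib_left algebra_simps)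

text \<open>Kept monic: the normalising weight \<open>u_vec \<alpha> $ i\<close> enters only in the
  interpolant, so the top coefficients of its summands are the terms of a divided
  difference.\<close>

definition lagrange_basis :: "('a::field) ^ 'n \<Rightarrow> 'n \<Rightarrow> 'a poly" where
  "lagrange_basis \<alpha> i = (\<Prod>j\<in>UNIV - {i}. [:- \<alpha> $ j, 1:])"

lemma degree_lagrange_basis: "degree (lagrange_basis (\<alpha> :: ('a::field) ^ 'n) i) = CARD('n) - 1"
  by (simp add: lagrange_basis_def degree_prod_sum_eq)

lemma coeff_lagrange_basis: "coeff (lagrange_basis (\<alpha> :: ('a::field) ^ 'n) i) (CARD('n) - 1) = 1"
  using lead_coeff_prod[of "\<lambda>j. [:- \<alpha> $ j, 1:]" "UNIV - {i}"]
  by (simp add: degree_lagrange_basis flip: lagrange_basis_def)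

lemma u_vec_nonzero:
  fixes \<alpha> :: "('a::field) ^ 'n"
  assumes "inj (\<lambda>i. \<alpha> $ i)"
  shows "u_vec \<alpha> $ i \<noteq> 0"
  using assms by (auto simp: u_vec_def inj_def)

lemma poly_lagrange_basis:
  fixes \<alpha> :: "('a::field) ^ 'n"
  assumes "inj (\<lambda>i. \<alpha> $ i)"
  shows "u_vec \<alpha> $ i * poly (lagrange_basis \<alpha> i) (\<alpha> $ j) = (if i = j then 1 else 0)"
proof (cases "i = j")
  case True
  have "(\<Prod>k\<in>UNIV - {j}. \<alpha> $ j - \<alpha> $ k) \<noteq> 0"
    using assms by (auto simp: inj_def)
  with True show ?thesis
    by (simp add: u_vec_def lagrange_basis_def poly_prod)
next
  case False
  then show ?thesis
    by (auto simp: lagrange_basis_def poly_prod intro!: prod_zero)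
qed

definition lagrange_interpolant :: "('a::field) ^ 'n \<Rightarrow> ('n \<Rightarrow> 'a) \<Rightarrow> 'a poly" where
  "lagrange_interpolant \<alpha> y = (\<Sum>i\<in>UNIV. smult (u_vec \<alpha> $ i * y i) (lagrange_basis \<alpha> i))"

lemma degree_lagrange_interpolant:
  "degree (lagrange_interpolant (\<alpha> :: ('a::field) ^ 'n) y) < CARD('n)"
  unfolding lagrange_interpolant_def
  by (rule degree_sum_less)
    (auto intro: le_less_trans[OF degree_smult_le] simp: degree_lagrange_basis)

lemma poly_lagrange_interpolant:
  fixes \<alpha> :: "('a::field) ^ 'n"
  assumes "inj (\<lambda>i. \<alpha> $ i)"
  shows "poly (lagrange_interpolant \<alpha> y) (\<alpha> $ j) = y j"
proof -
  have "poly (lagrange_interpolant \<alpha> y) (\<alpha> $ j) =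
      (\<Sum>i\<in>UNIV. y i * (u_vec \<alpha> $ i * poly (lagrange_basis \<alpha> i) (\<alpha> $ j)))"
    by (simp add: lagrange_interpolant_def poly_sum algebra_simps)
  also have "\<dots> = y j"
    by (simp add: poly_lagrange_basis[OF assms] if_distrib sum.delta cong: if_cong)
  finally show ?thesis .
qed

text \<open>The interpolant through the values of p is p itself; compare coefficients of x^(n-1),
  where every basis polynomial has coefficient 1.\<close>

lemma divided_difference_eq_coeff:
  fixes \<alpha> :: "('a::field) ^ 'n"
  assumes inj: "inj (\<lambda>i. \<alpha> $ i)" and deg: "degree p < CARD('n)"
  shows "divided_difference \<alpha> p = coeff p (CARD('n) - 1)"
proof -
  let ?q = "lagrange_interpolant \<alpha> (\<lambda>i. poly p (\<alpha> $ i))"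
  have card: "card (range (\<lambda>i. \<alpha> $ i)) = CARD('n)"
    by (rule card_image[OF inj])
  have "p = ?q"
    by (rule poly_eqI_degree[of "range (\<lambda>i. \<alpha> $ i)"])
      (auto simp: card deg degree_lagrange_interpolant poly_lagrange_interpolant[OF inj])
  then have "coeff p (CARD('n) - 1) = coeff ?q (CARD('n) - 1)"
    by simp
  also have "\<dots> = divided_difference \<alpha> p"
    using coeff_lagrange_basis[of \<alpha>]
    by (simp add: lagrange_interpolant_def coeff_sum divided_difference_def)
  finally show ?thesis by simp
qed

text \<open>In particular P_(n-1) = 1, so the divisions in the definition of f are harmless, and
  every P_k with k < n-1 drops out below.\<close>

lemma power_sum_small:
  fixes \<alpha> :: "('a::field) ^ 'n"
  assumes "inj (\<lambda>i. \<alpha> $ i)" and "k < CARD('n)"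
  shows "power_sum \<alpha> k = (if k = CARD('n) - 1 then 1 else 0)"
  using divided_difference_eq_coeff[OF assms(1), of "monom 1 k"] assms(2)
    divided_difference_monom[of \<alpha> 1 k]
  by (simp add: degree_monom_eq)

section \<open>The code and its parity-check matrix\<close>

text \<open>The cross relation expresses, without division, that the coefficients at l and k are
  proportional to \<open>lam\<close> and \<open>\<eta>\<close>, as in the twisted generator.\<close>

lemma TGRS_iff:
  fixes \<alpha> v :: "('a::field) ^ 'n"
  assumes l: "l < k" and nz: "\<not> (\<eta> = 0 \<and> lam = 0)"
  shows "x \<in> TGRS k \<alpha> v l \<eta> lam \<longleftrightarrow>
    (\<exists>p. degree p \<le> k \<and> lam * coeff p k = \<eta> * coeff p l \<and> (\<forall>i. x $ i = v $ i * poly p (\<alpha> $ i)))"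
    (is "_ \<longleftrightarrow> ?P x")
proof
  let ?B = "insert (\<chi> i. v $ i * (lam * (\<alpha> $ i) ^ l + \<eta> * (\<alpha> $ i) ^ k))
        {(\<chi> i. v $ i * (\<alpha> $ i) ^ j) | j. j < k \<and> j \<noteq> l}"
  assume "x \<in> TGRS k \<alpha> v l \<eta> lam"
  then have "x \<in> vec.span ?B"
    by (simp add: TGRS_def)
  then show "?P x"
  proof (induction rule: vec.span_induct_alt)
    case base
    show ?case by (intro exI[of _ 0]) auto
  next
    case (step c y z)
    from step.hyps(1) have "?P y"
    proof safe
      show "?P (\<chi> i. v $ i * (lam * (\<alpha> $ i) ^ l + \<eta> * (\<alpha> $ i) ^ k))"
        using l by (intro exI[of _ "monom lam l + monom \<eta> k"])
          (auto simp: poly_monom algebra_simps intro!: degree_add_le order.trans[OF degree_monom_le])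
    next
      fix j assume "j < k" "j \<noteq> l"
      then show "?P (\<chi> i. v $ i * (\<alpha> $ i) ^ j)"
        by (intro exI[of _ "monom 1 j"])
          (auto simp: poly_monom intro!: order.trans[OF degree_monom_le])
    qed
    then obtain p where p: "degree p \<le> k" "lam * coeff p k = \<eta> * coeff p l"
        "\<forall>i. y $ i = v $ i * poly p (\<alpha> $ i)" by blast
    from step obtain q where q: "degree q \<le> k" "lam * coeff q k = \<eta> * coeff q l"
        "\<forall>i. z $ i = v $ i * poly q (\<alpha> $ i)" by blast
    show ?case
    proof (intro exI conjI)
      show "degree (smult c p + q) \<le> k"
        using p q by (intro degree_add_le order.trans[OF degree_smult_le])
      show "lam * coeff (smult c p + q) k = \<eta> * coeff (smult c p + q) l"
        using p(2) q(2) by (simp add: algebra_simps)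
      show "\<forall>i. (c *s y + z) $ i = v $ i * poly (smult c p + q) (\<alpha> $ i)"
        using p(3) q(3) by (simp add: algebra_simps)
    qed
  qed
next
  let ?B = "insert (\<chi> i. v $ i * (lam * (\<alpha> $ i) ^ l + \<eta> * (\<alpha> $ i) ^ k))
        {(\<chi> i. v $ i * (\<alpha> $ i) ^ j) | j. j < k \<and> j \<noteq> l}"
  assume "?P x"
  then obtain p where p: "degree p \<le> k" "lam * coeff p k = \<eta> * coeff p l"
      "\<forall>i. x $ i = v $ i * poly p (\<alpha> $ i)" by blast
  \<comment> \<open>As \<open>lam\<close> and \<open>\<eta>\<close> are not both zero, the relation
    yields a common factor \<kappa>: the coordinate at the twisted generator.\<close>
  obtain \<kappa> where \<kappa>: "coeff p l = \<kappa> * lam" "coeff p k = \<kappa> * \<eta>"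
  proof (cases "\<eta> = 0")
    case True
    then show ?thesis using nz p(2) that[of "coeff p l / lam"] by auto
  next
    case False
    then show ?thesis using p(2) that[of "coeff p k / \<eta>"] by (auto simp: field_simps)
  qed
  have eq: "{..k} = insert l (insert k ({..<k} - {l}))"
    using l by auto
  have "poly p y = \<kappa> * (lam * y ^ l + \<eta> * y ^ k) + (\<Sum>j\<in>{..<k} - {l}. coeff p j * y ^ j)" for y
  proof -
    have "poly p y = poly (\<Sum>j\<le>k. monom (coeff p j) j) y"
      using poly_as_sum_of_monoms'[OF p(1)] by simp
    also have "\<dots> = (\<Sum>j\<le>k. coeff p j * y ^ j)"
      by (simp add: poly_sum poly_monom)
    also have "\<dots> = coeff p l * y ^ l + (coeff p k * y ^ k + (\<Sum>j\<in>{..<k} - {l}. coeff p j * y ^ j))"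
      unfolding eq using l by (subst sum.insert; (subst sum.insert)?; simp)
    finally show ?thesis by (simp add: \<kappa> algebra_simps)
  qed
  then have x: "x = \<kappa> *s (\<chi> i. v $ i * (lam * (\<alpha> $ i) ^ l + \<eta> * (\<alpha> $ i) ^ k))
      + (\<Sum>j\<in>{..<k} - {l}. coeff p j *s (\<chi> i. v $ i * (\<alpha> $ i) ^ j))"
    by (simp add: vec_eq_iff p(3) algebra_simps sum_distrib_left)
  show "x \<in> TGRS k \<alpha> v l \<eta> lam"
    unfolding TGRS_def
    by (subst x, intro vec.span_add vec.span_scale vec.span_sum vec.span_base) auto
qed

definition parity_check_poly :: "nat \<Rightarrow> ('a::field) poly \<Rightarrow> nat \<Rightarrow> 'a poly" where
  "parity_check_poly t f k = (if k = t - 1 then monom 1 (t - 1) + f else monom 1 k)"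

lemma parity_check_eq:
  "parity_check t \<alpha> w f k $ i = w $ i * poly (parity_check_poly t f k) (\<alpha> $ i)"
  by (simp add: parity_check_def parity_check_poly_def poly_monom)

text \<open>The factor v_i of the word cancels the denominator of w_i = u_i / v_i.\<close>

lemma syndrome_eq_divided_difference:
  fixes \<alpha> v :: "('a::field) ^ 'n"
  assumes "\<forall>i. v $ i \<noteq> 0" and "\<forall>i. x $ i = v $ i * poly p (\<alpha> $ i)"
  shows "syndrome (parity_check t \<alpha> (w_vec \<alpha> v) f) x k =
    divided_difference \<alpha> (parity_check_poly t f k * p)"
  using assms by (auto simp: syndrome_def parity_check_eq divided_difference_def w_vec_def intro!: sum.cong)

section \<open>The functional defined by the last row of \<open>H\<close>\<close>

lemma divided_difference_f_poly:
  fixes \<alpha> :: "('a::field) ^ 'n"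
  assumes l: "l < CARD('n) - t" and "\<eta> \<noteq> 0"
  shows "divided_difference \<alpha> (f_poly t \<alpha> l \<eta> lam * monom 1 j) =
    (\<Sum>i\<le>CARD('n) - t - l - 1. f_top \<alpha> i * power_sum \<alpha> (CARD('n) - l - 1 - i + j))
      + f_low t \<alpha> l \<eta> lam * power_sum \<alpha> (t - 1 + j)"
proof -
  let ?n = "CARD('n)"
  have "f_poly t \<alpha> l \<eta> lam * monom 1 j =
      (\<Sum>m = t..?n - l - 1. monom (f_top \<alpha> (?n - l - 1 - m)) (m + j))
      + monom (f_low t \<alpha> l \<eta> lam) (t - 1 + j)"
    using \<open>\<eta> \<noteq> 0\<close> by (simp add: f_poly_def Let_def distrib_right sum_distrib_right mult_monom)
  also have "divided_difference \<alpha> \<dots> =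
      (\<Sum>m = t..?n - l - 1. f_top \<alpha> (?n - l - 1 - m) * power_sum \<alpha> (m + j))
      + f_low t \<alpha> l \<eta> lam * power_sum \<alpha> (t - 1 + j)"
    by (simp add: divided_difference_add divided_difference_sum divided_difference_monom)
  \<comment> \<open>The substitution i = n-l-1-m counts from the top, as \<open>f_top\<close> does;
    the bound on l keeps the subtractions exact.\<close>
  also have "(\<Sum>m = t..?n - l - 1. f_top \<alpha> (?n - l - 1 - m) * power_sum \<alpha> (m + j)) =
      (\<Sum>i\<le>?n - t - l - 1. f_top \<alpha> i * power_sum \<alpha> (?n - l - 1 - i + j))"
    using l by (intro sum.reindex_bij_witness[of _ "\<lambda>i. ?n - l - 1 - i" "\<lambda>m. ?n - l - 1 - m"])
      (auto simp: add.commute)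
  finally show ?thesis .
qed

text \<open>Read from the top, the coefficients of f are those of the inverse of the power series
  with coefficients P_(n-1), P_n, ...; the sum is the coefficient of x^(j-l) in the product. Since j
  < n-t, the truncation of the sum loses no nonzero term.\<close>

lemma f_top_orthogonal:
  fixes \<alpha> :: "('a::field) ^ 'n"
  assumes inj: "inj (\<lambda>i. \<alpha> $ i)" and t: "0 < t" and l: "l < CARD('n) - t" and j: "j < CARD('n) - t"
  shows "(\<Sum>i\<le>CARD('n) - t - l - 1. f_top \<alpha> i * power_sum \<alpha> (CARD('n) - l - 1 - i + j)) =
    (if j = l then 1 else 0)" (is "?S = _")
proof -
  let ?n = "CARD('n)" and ?N = "CARD('n) - t - l - 1"
  consider "j < l" | "j = l" | r where "j = l + 1 + r"
    using less_imp_Suc_add[of l j] by (metis add.commute linorder_less_linear plus_1_eq_Suc add_Suc)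
  then show ?thesis
  proof cases
    case 1
    then have "f_top \<alpha> i * power_sum \<alpha> (?n - l - 1 - i + j) = 0" if "i \<le> ?N" for i
      using that l by (subst power_sum_small[OF inj]) auto
    then have "?S = 0" by (intro sum.neutral) auto
    with 1 show ?thesis by simp
  next
    case 2
    have "?S = (\<Sum>i\<le>?N. if i = 0 then 1 else 0)"
    proof (rule sum.cong[OF refl])
      fix i assume "i \<in> {..?N}"
      then show "f_top \<alpha> i * power_sum \<alpha> (?n - l - 1 - i + j) = (if i = 0 then 1 else 0)"
        using l 2 by (subst power_sum_small[OF inj]) auto
    qed
    with 2 show ?thesis by simp
  next
    case 3
    have r: "Suc r \<le> ?N" using 3 j by linarith
    have "?S = (\<Sum>i\<le>Suc r. f_top \<alpha> i * power_sum \<alpha> (?n + r - i))"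
    proof (rule sum.mono_neutral_cong_right)
      show "\<forall>i\<in>{..?N} - {..Suc r}. f_top \<alpha> i * power_sum \<alpha> (?n - l - 1 - i + j) = 0"
      proof
        fix i assume i: "i \<in> {..?N} - {..Suc r}"
        then have "power_sum \<alpha> (?n - l - 1 - i + j) = 0"
          using l 3 by (subst power_sum_small[OF inj]) auto
        then show "f_top \<alpha> i * power_sum \<alpha> (?n - l - 1 - i + j) = 0" by simp
      qed
      fix i assume i: "i \<in> {..Suc r}"
      then have "?n - l - 1 - i + j = ?n + r - i"
        using r 3 l by simp
      then show "f_top \<alpha> i * power_sum \<alpha> (?n - l - 1 - i + j) = f_top \<alpha> i * power_sum \<alpha> (?n + r - i)"
        by simp
    qed (use r in auto)
    \<comment> \<open>The last summand is \<open>f_top \<alpha> (Suc r)\<close> times P_(n-1) = 1,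
      and the recursion makes it cancel the others.\<close>
    also have "\<dots> = 0"
      by (simp add: power_sum_small[OF inj])
    finally show ?thesis using 3 by simp
  qed
qed

lemma parity_check_last_row_low:
  fixes \<alpha> :: "('a::field) ^ 'n"
  assumes inj: "inj (\<lambda>i. \<alpha> $ i)" and t: "0 < t" and l: "l < CARD('n) - t" and j: "j < CARD('n) - t"
  shows "divided_difference \<alpha> ((monom 1 (t - 1) + f_poly t \<alpha> l \<eta> lam) * monom 1 j) =
    (if j = l \<and> \<eta> \<noteq> 0 then 1 else 0)"
proof -
  have low: "power_sum \<alpha> (t - 1 + j) = 0"
    using t j by (subst power_sum_small[OF inj]) auto
  show ?thesis
  proof (cases "\<eta> = 0")
    case True
    then show ?thesis
      using low by (simp add: f_poly_def mult_monom divided_difference_monom)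
  next
    case False
    show ?thesis
      unfolding distrib_right divided_difference_add divided_difference_f_poly[OF l False]
        f_top_orthogonal[OF inj t l j] mult_monom divided_difference_monom
      using False low by simp
  qed
qed

text \<open>At this exponent x^(t-1) and a_(t-1) meet P_(n-1) = 1. In \<open>f_low\<close> the term
  -1 cancels the x^(t-1) of the row and the sum cancels the rest of f, which leaves - lam /
  \<eta>.\<close>

lemma parity_check_last_row_top:
  fixes \<alpha> :: "('a::field) ^ 'n"
  assumes inj: "inj (\<lambda>i. \<alpha> $ i)" and t: "0 < t" and l: "l < CARD('n) - t"
  shows "divided_difference \<alpha> ((monom 1 (t - 1) + f_poly t \<alpha> l \<eta> lam) * monom 1 (CARD('n) - t)) =
    (if \<eta> = 0 then 1 else - (lam / \<eta>))"
proof -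
  let ?n = "CARD('n)"
  have eq: "t - 1 + (?n - t) = ?n - 1"
    using t l by auto
  have top: "power_sum \<alpha> (t - 1 + (?n - t)) = 1"
    unfolding eq by (simp add: power_sum_small[OF inj])
  show ?thesis
  proof (cases "\<eta> = 0")
    case True
    then show ?thesis
      using top by (simp add: f_poly_def mult_monom divided_difference_monom)
  next
    case False
    have "(\<Sum>i\<le>?n - t - l - 1. f_top \<alpha> i * power_sum \<alpha> (?n - l - 1 - i + (?n - t))) =
        (\<Sum>i\<le>?n - t - l - 1. f_top \<alpha> i * power_sum \<alpha> (2 * ?n - t - l - 1 - i))"
      using l by (intro sum.cong refl arg_cong2[where f = "(*)"] arg_cong[where f = "power_sum \<alpha>"]) auto
    then show ?thesis
      unfolding distrib_right divided_difference_add divided_difference_f_poly[OF l False]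
        mult_monom divided_difference_monom top
      using False power_sum_small[OF inj, of "?n - 1"]
      by (simp add: f_low_def Let_def field_simps)
  qed
qed

text \<open>Linear extension from monomials. If \<open>\<eta>\<close> and \<open>lam\<close> are not
  both zero, this value vanishes exactly under the cross relation of
  \<open>TGRS_iff\<close>.\<close>

lemma parity_check_last_row:
  fixes \<alpha> :: "('a::field) ^ 'n"
  assumes inj: "inj (\<lambda>i. \<alpha> $ i)" and t: "0 < t" and l: "l < CARD('n) - t"
    and deg: "degree p \<le> CARD('n) - t"
  shows "divided_difference \<alpha> ((monom 1 (t - 1) + f_poly t \<alpha> l \<eta> lam) * p) =
    (if \<eta> = 0 then coeff p (CARD('n) - t)
     else coeff p l - lam / \<eta> * coeff p (CARD('n) - t))"
proof -
  let ?n = "CARD('n)" and ?h = "monom 1 (t - 1) + f_poly t \<alpha> l \<eta> lam"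
  have "?h * p = ?h * (\<Sum>j\<le>?n - t. monom (coeff p j) j)"
    by (simp add: poly_as_sum_of_monoms'[OF deg])
  also have "\<dots> = (\<Sum>j\<le>?n - t. smult (coeff p j) (?h * monom 1 j))"
    by (simp only: sum_distrib_left mult_smult_right[symmetric] smult_monom mult_1_right)
  finally have "divided_difference \<alpha> (?h * p) =
      (\<Sum>j\<le>?n - t. coeff p j * divided_difference \<alpha> (?h * monom 1 j))"
    by (simp only: divided_difference_sum divided_difference_smult)
  also have "\<dots> = (\<Sum>j<?n - t. coeff p j * divided_difference \<alpha> (?h * monom 1 j))
      + coeff p (?n - t) * divided_difference \<alpha> (?h * monom 1 (?n - t))"
    by (simp only: lessThan_Suc_atMost[symmetric] sum.lessThan_Suc)
  also have "(\<Sum>j<?n - t. coeff p j * divided_difference \<alpha> (?h * monom 1 j)) =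
      (\<Sum>j<?n - t. if j = l then (if \<eta> = 0 then 0 else coeff p l) else 0)"
    by (intro sum.cong refl) (subst parity_check_last_row_low[OF inj t l]; simp)
  also have "\<dots> = (if \<eta> = 0 then 0 else coeff p l)"
    using l by simp
  finally show ?thesis
    by (subst (asm) parity_check_last_row_top[OF inj t l]) (simp split: if_splits)
qed

lemma parity_check_first_rows:
  fixes \<alpha> :: "('a::field) ^ 'n"
  assumes inj: "inj (\<lambda>i. \<alpha> $ i)" and deg: "degree p < CARD('n)" and t: "0 < t" "t \<le> CARD('n)"
  shows "(\<forall>k<t - 1. divided_difference \<alpha> (monom 1 k * p) = 0) \<longleftrightarrow> degree p \<le> CARD('n) - t"
proof
  let ?n = "CARD('n)"
  assume dd: "\<forall>k<t - 1. divided_difference \<alpha> (monom 1 k * p) = 0"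
  \<comment> \<open>Row k reads the coefficient of x^(n-1-k) once all higher ones are known to
    vanish.\<close>
  have "degree p \<le> ?n - 1 - k" if "k \<le> t - 1" for k
    using that
  proof (induction k)
    case 0
    then show ?case using deg by simp
  next
    case (Suc k)
    then have le: "degree p \<le> ?n - 1 - k" by simp
    have "degree (monom 1 k * p) < ?n"
      using le Suc.prems t by (intro le_less_trans[OF degree_mult_le])
        (auto intro: le_less_trans[OF add_mono[OF degree_monom_le le]])
    then have "coeff (monom 1 k * p) (?n - 1) = 0"
      using dd Suc.prems divided_difference_eq_coeff[OF inj, of "monom 1 k * p"] by simp
    then have "coeff p (?n - 1 - k) = 0"
      using Suc.prems t by (simp add: coeff_monom_mult split: if_splits)
    \<comment> \<open>The second alternative covers p = 0, whose degree is 0 here.\<close>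
    then have "degree p \<noteq> ?n - 1 - k \<or> degree p = 0"
      by (metis leading_coeff_0_iff degree_0)
    with le show ?case by auto
  qed
  from this[of "t - 1"] show "degree p \<le> ?n - t" using t by simp
next
  let ?n = "CARD('n)"
  assume le: "degree p \<le> ?n - t"
  show "\<forall>k<t - 1. divided_difference \<alpha> (monom 1 k * p) = 0"
  proof safe
    fix k assume k: "k < t - 1"
    have "degree (monom 1 k * p) \<le> k + (?n - t)"
      by (rule order.trans[OF degree_mult_le]) (auto intro: add_mono degree_monom_le le)
    then have "degree (monom 1 k * p) < ?n - 1"
      using k t by linarith
    then show "divided_difference \<alpha> (monom 1 k * p) = 0"
      by (subst divided_difference_eq_coeff[OF inj]) (auto intro: coeff_eq_0)
  qed
qed

lemma parity_check_TGRS: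
  fixes \<alpha> v :: "('a::field) ^ 'n"
  assumes inj: "inj (\<lambda>i. \<alpha> $ i)" and v: "\<forall>i. v $ i \<noteq> 0" and t: "0 < t" and l: "l < CARD('n) - t"
    and nz: "\<not> (\<eta> = 0 \<and> lam = 0)"
  shows "x \<in> TGRS (CARD('n) - t) \<alpha> v l \<eta> lam \<longleftrightarrow>
    (\<forall>k<t. syndrome (parity_check t \<alpha> (w_vec \<alpha> v) (f_poly t \<alpha> l \<eta> lam)) x k = 0)" (is "_ \<longleftrightarrow> ?K x")
proof -
  let ?n = "CARD('n)" and ?f = "f_poly t \<alpha> l \<eta> lam"
  have K: "?K x \<longleftrightarrow> degree p \<le> ?n - t \<and> lam * coeff p (?n - t) = \<eta> * coeff p l"
    if deg: "degree p < ?n" and x: "\<forall>i. x $ i = v $ i * poly p (\<alpha> $ i)" for p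
  proof -
    have "?K x \<longleftrightarrow> (\<forall>k<t. divided_difference \<alpha> (parity_check_poly t ?f k * p) = 0)"
      by (simp add: syndrome_eq_divided_difference[OF v x])
    also have "\<dots> \<longleftrightarrow> (\<forall>k<t - 1. divided_difference \<alpha> (parity_check_poly t ?f k * p) = 0)
        \<and> divided_difference \<alpha> (parity_check_poly t ?f (t - 1) * p) = 0"
      using t by (metis Suc_diff_1 less_Suc_eq)
    also have "\<dots> \<longleftrightarrow> (\<forall>k<t - 1. divided_difference \<alpha> (monom 1 k * p) = 0)
        \<and> divided_difference \<alpha> ((monom 1 (t - 1) + ?f) * p) = 0"
      by (simp add: parity_check_poly_def)
    also have "\<dots> \<longleftrightarrow> degree p \<le> ?n - t \<and> divided_difference \<alpha> ((monom 1 (t - 1) + ?f) * p) = 0"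
      using parity_check_first_rows[OF inj deg t] l by simp
    also have "\<dots> \<longleftrightarrow> degree p \<le> ?n - t \<and> lam * coeff p (?n - t) = \<eta> * coeff p l"
      using nz by (intro conj_cong refl) (subst parity_check_last_row[OF inj t l]; auto simp: field_simps)
    finally show ?thesis .
  qed
  have lt: "degree p \<le> ?n - t \<Longrightarrow> degree p < ?n" for p :: "'a poly"
    using t l by linarith
  \<comment> \<open>Interpolation writes an arbitrary word as v_i p(\<alpha>_i) with deg p < n, so
    both sides become conditions on coefficients.\<close>
  let ?p = "lagrange_interpolant \<alpha> (\<lambda>i. x $ i / v $ i)"
  have "\<forall>i. x $ i = v $ i * poly ?p (\<alpha> $ i)"
    using v by (simp add: poly_lagrange_interpolant[OF inj])
  with K[OF degree_lagrange_interpolant this] K lt show ?thesis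
    unfolding TGRS_iff[OF l nz] by blast
qed

section \<open>Error locators\<close>

lemma smult_sum_right: "smult c (\<Sum>x\<in>A. f x) = (\<Sum>x\<in>A. smult c (f x))"
  by (induction A rule: infinite_finite_induct) (simp_all add: smult_add_right)

lemma card_root_set_le:
  fixes \<alpha> :: "('a::field) ^ 'n"
  assumes "inj (\<lambda>i. \<alpha> $ i)" and "\<sigma> \<noteq> 0"
  shows "card (root_set \<alpha> \<sigma>) \<le> degree \<sigma>"
proof -
  have "card (root_set \<alpha> \<sigma>) = card ((\<lambda>i. \<alpha> $ i) ` root_set \<alpha> \<sigma>)"
    using assms(1) by (intro card_image[symmetric]) (auto simp: inj_def inj_on_def)
  also have "\<dots> \<le> card {x. poly \<sigma> x = 0}"
    using assms(2) by (intro card_mono poly_roots_finite) (auto simp: root_set_def)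
  also have "\<dots> \<le> degree \<sigma>"
    by (rule card_poly_roots_bound[OF assms(2)])
  finally show ?thesis .
qed

lemma root_set_factor:
  assumes "i \<in> root_set \<alpha> \<sigma>"
  shows "\<sigma> = [:- \<alpha> $ i, 1:] * (\<sigma> div [:- \<alpha> $ i, 1:])"
  using assms by (simp add: root_set_def poly_eq_0_iff_dvd del: mult_pCons_left)

lemma pderiv_root_set:
  assumes "i \<in> root_set \<alpha> \<sigma>"
  shows "poly (pderiv \<sigma>) (\<alpha> $ i) = poly (\<sigma> div [:- \<alpha> $ i, 1:]) (\<alpha> $ i)"
  by (subst root_set_factor[OF assms]) (simp add: pderiv_mult pderiv_pCons del: mult_pCons_left)

lemma cofactor_other_root:
  fixes \<alpha> :: "('a::field) ^ 'n"
  assumes "inj (\<lambda>i. \<alpha> $ i)" and "i \<in> root_set \<alpha> \<sigma>" and "j \<in> root_set \<alpha> \<sigma>" and "i \<noteq> j"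
  shows "poly (\<sigma> div [:- \<alpha> $ j, 1:]) (\<alpha> $ i) = 0"
proof -
  have "poly ([:- \<alpha> $ j, 1:] * (\<sigma> div [:- \<alpha> $ j, 1:])) (\<alpha> $ i) = 0"
    using assms(2) root_set_factor[OF assms(3)] by (simp add: root_set_def)
  moreover have "\<alpha> $ i \<noteq> \<alpha> $ j"
    using assms(1,4) by (auto simp: inj_def)
  ultimately show ?thesis
    by (simp del: mult_pCons_left)
qed

text \<open>At a multiple root, the cofactor of x - \<alpha>_i would keep all roots of \<sigma>
  among the points while its degree is one smaller.\<close>

lemma pderiv_locator_nonzero:
  fixes \<alpha> :: "('a::field) ^ 'n"
  assumes inj: "inj (\<lambda>i. \<alpha> $ i)" and "\<sigma> \<noteq> 0" and deg: "degree \<sigma> = card (root_set \<alpha> \<sigma>)"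
    and i: "i \<in> root_set \<alpha> \<sigma>"
  shows "poly (pderiv \<sigma>) (\<alpha> $ i) \<noteq> 0"
proof
  let ?\<rho> = "\<sigma> div [:- \<alpha> $ i, 1:]"
  assume "poly (pderiv \<sigma>) (\<alpha> $ i) = 0"
  then have "poly ?\<rho> (\<alpha> $ i) = 0"
    by (simp add: pderiv_root_set[OF i])
  then have "root_set \<alpha> \<sigma> \<subseteq> root_set \<alpha> ?\<rho>"
    using cofactor_other_root[OF inj _ i] by (force simp: root_set_def)
  then have "card (root_set \<alpha> \<sigma>) \<le> card (root_set \<alpha> ?\<rho>)"
    by (intro card_mono) auto
  moreover have "?\<rho> \<noteq> 0"
    using root_set_factor[OF i] \<open>\<sigma> \<noteq> 0\<close> by auto
  moreover have "degree \<sigma> = 1 + degree ?\<rho>"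
    using \<open>?\<rho> \<noteq> 0\<close> by (subst root_set_factor[OF i]) (subst degree_mult_eq; simp)
  ultimately show False
    using card_root_set_le[OF inj, of ?\<rho>] deg by simp
qed

text \<open>
  The evaluator that the locator \<open>\<sigma>\<close> and the error word \<open>e\<close> determine:
  \<open>S \<sigma> \<equiv> a \<sigma> + \<omega>\<close> modulo \<open>x^t\<close> follows from
  \<open>(\<alpha>\<^sub>j^t - x^t) / (\<alpha>\<^sub>j - x) = \<Sum>\<^bsub>i<t\<^esub> \<alpha>\<^sub>j^(t-1-i) x^i\<close>.
\<close>

definition evaluator ::
  "nat \<Rightarrow> ('a::field) ^ 'n \<Rightarrow> 'a ^ 'n \<Rightarrow> 'a poly \<Rightarrow> 'a poly \<Rightarrow> 'a ^ 'n \<Rightarrow> 'a poly" where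
  "evaluator t \<alpha> w f \<sigma> e = smult (a_coeff \<alpha> w f \<sigma> e) \<sigma> + omega_poly t \<alpha> w \<sigma> e"

text \<open>The Euclidean algorithm finds a locator only up to a scalar, and the evaluator has to
  scale with it.\<close>

lemma evaluator_smult:
  assumes "c \<noteq> 0"
  shows "evaluator t \<alpha> w f (smult c \<sigma>) e = smult c (evaluator t \<alpha> w f \<sigma> e)"
proof -
  have "root_set \<alpha> (smult c \<sigma>) = root_set \<alpha> \<sigma>"
    using assms by (auto simp: root_set_def)
  then show ?thesis
    by (simp add: evaluator_def a_coeff_def omega_poly_def div_smult_left smult_diff_right
        smult_sum_right mult_ac)
qed

lemma sum_monom_times_linear:
  fixes a :: "'a::field"
  shows "(\<Sum>i<t. monom (a ^ (t - 1 - i)) i) * [:- a, 1:] = monom 1 t - [:a ^ t:]"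
proof (induction t)
  case 0
  then show ?case by simp
next
  case (Suc t)
  have "(\<Sum>i<Suc t. monom (a ^ (Suc t - 1 - i)) i) =
      smult a (\<Sum>i<t. monom (a ^ (t - 1 - i)) i) + monom 1 t"
    by (auto simp: smult_sum_right smult_monom Suc_diff_Suc simp flip: power_Suc intro!: sum.cong)
  then have "(\<Sum>i<Suc t. monom (a ^ (Suc t - 1 - i)) i) * [:- a, 1:] =
      smult a (monom 1 t - [:a ^ t:]) + monom 1 t * [:- a, 1:]"
    by (simp only: distrib_right mult_smult_left Suc)
  also have "\<dots> = monom 1 (Suc t) - [:a ^ Suc t:]"
    by (intro poly_eqI) (auto simp: coeff_pCons split: nat.splits)
  finally show ?case .
qed

text \<open>The reversed order of the coefficients puts the last row of H at x^0, so f contributes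
  only a constant for each position.\<close>

lemma syndrome_poly_parity_check:
  fixes \<alpha> :: "('a::field) ^ 'n"
  assumes "0 < t"
  shows "syndrome_poly t (syndrome (parity_check t \<alpha> w f) e) =
    (\<Sum>j\<in>UNIV. smult (e $ j * w $ j)
       ((\<Sum>i<t. monom ((\<alpha> $ j) ^ (t - 1 - i)) i) + [:poly f (\<alpha> $ j):]))"
    (is "?L = ?R")
proof (rule poly_eqI)
  fix k
  have "coeff ?L k = (if k < t then syndrome (parity_check t \<alpha> w f) e (t - 1 - k) else 0)"
    by (simp add: syndrome_poly_def coeff_sum)
  also have "\<dots> = coeff ?R k"
    using assms
    by (cases k) (auto simp: syndrome_def parity_check_def coeff_sum coeff_pCons algebra_simps
        split: nat.splits intro!: sum.cong)
  finally show "coeff ?L k = coeff ?R k" .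
qed

lemma evaluator_cong:
  fixes \<alpha> :: "('a::field) ^ 'n"
  assumes t: "0 < t" and supp: "support e \<subseteq> root_set \<alpha> \<sigma>"
  shows "[syndrome_poly t (syndrome (parity_check t \<alpha> w f) e) * \<sigma> = evaluator t \<alpha> w f \<sigma> e]
    (mod monom 1 t)"
proof -
  let ?J = "root_set \<alpha> \<sigma>" and ?\<rho> = "\<lambda>j. \<sigma> div [:- \<alpha> $ j, 1:]"
    and ?G = "\<lambda>j. \<Sum>i<t. monom ((\<alpha> $ j) ^ (t - 1 - i)) i"
  have "syndrome_poly t (syndrome (parity_check t \<alpha> w f) e) * \<sigma> =
      (\<Sum>j\<in>?J. smult (e $ j * w $ j) (?G j + [:poly f (\<alpha> $ j):])) * \<sigma>"
    unfolding syndrome_poly_parity_check[OF t] using supp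
    by (intro arg_cong2[where f = "(*)"] refl sum.mono_neutral_right) (auto simp: support_def)
  also have "\<dots> = (\<Sum>j\<in>?J. smult (e $ j * w $ j) (?G j * \<sigma> + smult (poly f (\<alpha> $ j)) \<sigma>))"
    by (simp add: sum_distrib_right distrib_right)
  also have "\<dots> = (\<Sum>j\<in>?J. smult (e $ j * w $ j)
      ((monom 1 t - [:(\<alpha> $ j) ^ t:]) * ?\<rho> j + smult (poly f (\<alpha> $ j)) \<sigma>))"
  proof (rule sum.cong[OF refl])
    fix j assume "j \<in> ?J"
    \<comment> \<open>The root \<alpha>_j of \<sigma> supplies the linear factor that collapses the
      geometric sum.\<close>
    then have "?G j * \<sigma> = (?G j * [:- \<alpha> $ j, 1:]) * ?\<rho> j"
      by (subst root_set_factor) (simp_all only: mult.assoc)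
    then show "smult (e $ j * w $ j) (?G j * \<sigma> + smult (poly f (\<alpha> $ j)) \<sigma>) =
        smult (e $ j * w $ j)
          ((monom 1 t - [:(\<alpha> $ j) ^ t:]) * ?\<rho> j + smult (poly f (\<alpha> $ j)) \<sigma>)"
      by (simp only: sum_monom_times_linear)
  qed
  also have "\<dots> = monom 1 t * (\<Sum>j\<in>?J. smult (e $ j * w $ j) (?\<rho> j)) + evaluator t \<alpha> w f \<sigma> e"
    by (simp add: evaluator_def a_coeff_def omega_poly_def smult_add_right smult_diff_right left_diff_distrib
        sum.distrib sum_subtractf sum_distrib_left smult_sum algebra_simps)
  finally show ?thesis
    by (simp add: cong_iff_dvd_diff)
qed

text \<open>At \<alpha>_i both a \<sigma> and all summands of \<omega> but the i-th vanish, and the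
  cofactor in that one takes the value of the derivative. Solved for e_i, this is the formula in
  \<open>error_values\<close>.\<close>

lemma poly_evaluator:
  fixes \<alpha> :: "('a::field) ^ 'n"
  assumes inj: "inj (\<lambda>i. \<alpha> $ i)" and i: "i \<in> root_set \<alpha> \<sigma>"
  shows "poly (evaluator t \<alpha> w f \<sigma> e) (\<alpha> $ i) =
    - (e $ i * w $ i * (\<alpha> $ i) ^ t * poly (pderiv \<sigma>) (\<alpha> $ i))"
proof -
  have "poly (evaluator t \<alpha> w f \<sigma> e) (\<alpha> $ i) =
      - (\<Sum>j\<in>root_set \<alpha> \<sigma>. e $ j * w $ j * (\<alpha> $ j) ^ t * poly (\<sigma> div [:- \<alpha> $ j, 1:]) (\<alpha> $ i))"
    using i by (simp add: evaluator_def omega_poly_def poly_sum root_set_def)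
  also have "(\<Sum>j\<in>root_set \<alpha> \<sigma>. e $ j * w $ j * (\<alpha> $ j) ^ t * poly (\<sigma> div [:- \<alpha> $ j, 1:]) (\<alpha> $ i)) =
      (\<Sum>j\<in>{i}. e $ j * w $ j * (\<alpha> $ j) ^ t * poly (\<sigma> div [:- \<alpha> $ j, 1:]) (\<alpha> $ i))"
    using i cofactor_other_root[OF inj i] by (intro sum.mono_neutral_right) auto
  finally show ?thesis
    by (simp add: pderiv_root_set[OF i])
qed

lemma error_values_evaluator:
  fixes \<alpha> :: "('a::field) ^ 'n"
  assumes inj: "inj (\<lambda>i. \<alpha> $ i)" and "\<forall>i. \<alpha> $ i \<noteq> 0" and "\<forall>i. w $ i \<noteq> 0"
    and \<sigma>: "\<sigma> \<noteq> 0" "degree \<sigma> = card (root_set \<alpha> \<sigma>)" and supp: "support e \<subseteq> root_set \<alpha> \<sigma>"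
  shows "error_values t \<alpha> w \<sigma> (evaluator t \<alpha> w f \<sigma> e) = e"
proof -
  have "error_values t \<alpha> w \<sigma> (evaluator t \<alpha> w f \<sigma> e) $ i = e $ i" for i
  proof (cases "i \<in> root_set \<alpha> \<sigma>")
    case True
    then show ?thesis
      using assms(2,3) pderiv_locator_nonzero[OF inj \<sigma> True]
      by (simp add: error_values_def poly_evaluator[OF inj])
  next
    case False
    then show ?thesis
      using supp by (auto simp: error_values_def support_def)
  qed
  then show ?thesis by (simp add: vec_eq_iff)
qed

lemma degree_omega_poly:
  fixes \<alpha> :: "('a::field) ^ 'n"
  assumes "\<sigma> \<noteq> 0"
  shows "omega_poly t \<alpha> w \<sigma> e = 0 \<or> degree (omega_poly t \<alpha> w \<sigma> e) < degree \<sigma>"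
proof (cases "root_set \<alpha> \<sigma> = {}")
  case True
  then show ?thesis by (simp add: omega_poly_def)
next
  case False
  then obtain i where i: "i \<in> root_set \<alpha> \<sigma>" by blast
  have less: "degree (\<sigma> div [:- \<alpha> $ j, 1:]) < degree \<sigma>" if j: "j \<in> root_set \<alpha> \<sigma>" for j
  proof -
    have "\<sigma> div [:- \<alpha> $ j, 1:] \<noteq> 0"
      using root_set_factor[OF j] \<open>\<sigma> \<noteq> 0\<close> by auto
    then have "degree ([:- \<alpha> $ j, 1:] * (\<sigma> div [:- \<alpha> $ j, 1:])) = 1 + degree (\<sigma> div [:- \<alpha> $ j, 1:])"
      by (subst degree_mult_eq) auto
    then show ?thesis
      unfolding root_set_factor[OF j, symmetric] by simp
  qed
  have "degree (omega_poly t \<alpha> w \<sigma> e) < degree \<sigma>"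
    unfolding omega_poly_def degree_minus
    using less less[OF i] by (intro degree_sum_less) (auto intro: le_less_trans[OF degree_smult_le])
  then show ?thesis ..
qed

lemma degree_evaluator_le:
  fixes \<alpha> :: "('a::field) ^ 'n"
  assumes "\<sigma> \<noteq> 0"
  shows "degree (evaluator t \<alpha> w f \<sigma> e) \<le> degree \<sigma>"
  unfolding evaluator_def using degree_omega_poly[OF assms, of t \<alpha> w e]
  by (intro degree_add_le) auto

text \<open>Both sides have degree at most |J|, the same coefficient at |J|, and vanish at the same
  |J| distinct points.\<close>

lemma locator_eq_prod:
  fixes \<alpha> :: "('a::field) ^ 'n"
  assumes inj: "inj (\<lambda>i. \<alpha> $ i)" and deg: "degree \<sigma> = card (root_set \<alpha> \<sigma>)"
  shows "\<sigma> = smult (lead_coeff \<sigma>) (\<Prod>j\<in>root_set \<alpha> \<sigma>. [:- \<alpha> $ j, 1:])" (is "_ = ?R")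
proof (rule poly_eqI_degree_lead_coeff)
  let ?J = "root_set \<alpha> \<sigma>" and ?P = "\<Prod>j\<in>root_set \<alpha> \<sigma>. [:- \<alpha> $ j, 1:]"
  have degP: "degree ?P = card ?J"
    by (simp add: degree_prod_sum_eq)
  have "lead_coeff ?P = 1"
    by (simp add: lead_coeff_prod)
  then show "coeff \<sigma> (card ?J) = coeff ?R (card ?J)"
    using deg degP by simp
  show "degree \<sigma> \<le> card ?J" "degree ?R \<le> card ?J"
    using deg degP degree_smult_le[of _ ?P] by auto
  have "card ((\<lambda>i. \<alpha> $ i) ` ?J) = card ?J"
    using inj by (intro card_image) (auto simp: inj_def inj_on_def)
  then show "card ?J \<le> card ((\<lambda>i. \<alpha> $ i) ` ?J)" by simp
  show "poly \<sigma> z = poly ?R z" if "z \<in> (\<lambda>i. \<alpha> $ i) ` ?J" for z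
    using that by (auto simp: poly_prod root_set_def)
qed

text \<open>Removes one factor at a time: d leaves the nonzero constant d(a_i) on division by x -
  a_i, so d divides a nonzero constant times the remaining product.\<close>

lemma dvd_prod_linear_imp_unit:
  fixes d :: "'a::field poly"
  assumes "finite J" and "d dvd (\<Prod>j\<in>J. [:- a j, 1:])" and "\<And>j. j \<in> J \<Longrightarrow> poly d (a j) \<noteq> 0"
  shows "is_unit d"
  using assms
proof (induction J rule: finite_induct)
  case empty
  then show ?case by simp
next
  case (insert i J)
  let ?P = "\<Prod>j\<in>J. [:- a j, 1:]" and ?s = "synthetic_div d (a i)"
  have "(L * s + [:c:]) * P = s * (L * P) + smult c P" for L s P :: "'a poly" and c
    by (simp add: algebra_simps)
  from this[of "[:- a i, 1:]" ?s "poly d (a i)" ?P]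
  have "d * ?P = ?s * ([:- a i, 1:] * ?P) + smult (poly d (a i)) ?P"
    by (simp only: synthetic_div_correct')
  moreover have "d dvd [:- a i, 1:] * ?P"
    using insert by simp
  ultimately have "d dvd smult (poly d (a i)) ?P"
    by (metis dvd_add_right_iff dvd_mult dvd_triv_left)
  with insert show ?case
    by (auto simp: dvd_smult_iff)
qed

text \<open>By \<open>poly_evaluator\<close>, the evaluator is nonzero at every root of \<sigma>
  because e is nonzero there; this is where the support must equal the root set. A common divisor
  thus misses all roots of \<sigma>.\<close>

lemma coprime_evaluator:
  fixes \<alpha> :: "('a::field) ^ 'n"
  assumes inj: "inj (\<lambda>i. \<alpha> $ i)" and "\<forall>i. \<alpha> $ i \<noteq> 0" and "\<forall>i. w $ i \<noteq> 0"
    and \<sigma>: "\<sigma> \<noteq> 0" "degree \<sigma> = card (root_set \<alpha> \<sigma>)" and supp: "support e = root_set \<alpha> \<sigma>"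
  shows "coprime \<sigma> (evaluator t \<alpha> w f \<sigma> e)"
proof -
  let ?\<tau> = "evaluator t \<alpha> w f \<sigma> e"
  show ?thesis
  proof (rule coprimeI)
    fix d assume "d dvd \<sigma>" and d: "d dvd ?\<tau>"
    then have "d dvd (\<Prod>j\<in>root_set \<alpha> \<sigma>. [:- \<alpha> $ j, 1:])"
      using \<sigma>(1) by (subst (asm) locator_eq_prod[OF inj \<sigma>(2)]) (simp add: dvd_smult_iff)
    then show "is_unit d"
    proof (rule dvd_prod_linear_imp_unit[rotated])
      fix j assume j: "j \<in> root_set \<alpha> \<sigma>"
      then have "e $ j \<noteq> 0"
        using supp by (auto simp: support_def)
      then have "poly ?\<tau> (\<alpha> $ j) \<noteq> 0"
        using assms(2,3) pderiv_locator_nonzero[OF inj \<sigma> j] by (simp add: poly_evaluator[OF inj j])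
      then show "poly d (\<alpha> $ j) \<noteq> 0"
        using d by (auto elim!: dvdE)
    qed simp
  qed
qed

lemma exists_locator:
  fixes \<alpha> :: "('a::field) ^ 'n"
  assumes inj: "inj (\<lambda>i. \<alpha> $ i)"
  obtains \<sigma> where "\<sigma> \<noteq> 0" and "root_set \<alpha> \<sigma> = J" and "degree \<sigma> = card J"
proof
  let ?P = "\<Prod>j\<in>J. [:- \<alpha> $ j, 1:]"
  show "?P \<noteq> 0" by simp
  show "root_set \<alpha> ?P = J"
    using inj by (auto simp: root_set_def poly_prod inj_def)
  show "degree ?P = card J" by (simp add: degree_prod_sum_eq)
qed

section \<open>The Euclidean algorithm\<close>

text \<open>
  The determinant \<open>\<tau>' \<sigma> - \<tau> \<sigma>'\<close> of two consecutive rows is preserved up to sign, so it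
  remains a nonzero multiple of \<open>x^t\<close>.
\<close>

definition euclid_inv :: "nat \<Rightarrow> ('a::field) poly \<Rightarrow> 'a euclid_state \<Rightarrow> bool" where
  "euclid_inv t S = (\<lambda>(\<sigma>', \<tau>', \<sigma>, \<tau>).
     monom 1 t dvd S * \<sigma>' - \<tau>' \<and> monom 1 t dvd S * \<sigma> - \<tau> \<and>
     (\<exists>\<epsilon>. \<epsilon> \<noteq> 0 \<and> \<tau>' * \<sigma> - \<tau> * \<sigma>' = monom \<epsilon> t) \<and>
     \<sigma> \<noteq> 0 \<and> (\<sigma>' = 0 \<or> degree \<sigma>' < degree \<sigma>) \<and>
     \<tau>' \<noteq> 0 \<and> (\<tau> = 0 \<or> degree \<tau> < degree \<tau>'))"

lemma degree_syndrome_poly: "0 < t \<Longrightarrow> degree (syndrome_poly t s) < t"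
  unfolding syndrome_poly_def
  by (intro degree_sum_less) (auto intro: le_less_trans[OF degree_monom_le])

lemma euclid_inv_init:
  assumes "degree S < t"
  shows "euclid_inv t S (0, monom 1 t, 1, S)"
  using assms by (auto simp: euclid_inv_def degree_monom_eq intro!: exI[of _ 1])

text \<open>The strict drop in degree from \<tau>' to \<tau> forces a nonconstant quotient; this
  makes the degrees of \<sigma> increase strictly.\<close>

lemma degree_euclid_quotient:
  assumes "euclid_inv t S (\<sigma>', \<tau>', \<sigma>, \<tau>)" and "\<tau> \<noteq> 0"
  shows "\<tau>' div \<tau> \<noteq> 0" and "0 < degree (\<tau>' div \<tau>)"
proof -
  have less: "degree \<tau> < degree \<tau>'"
    using assms by (auto simp: euclid_inv_def)
  moreover have "degree \<tau>' = degree (\<tau>' div \<tau> * \<tau>)"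
  proof -
    have "degree (\<tau>' mod \<tau>) < degree \<tau>'"
      using less degree_mod_less[OF \<open>\<tau> \<noteq> 0\<close>, of \<tau>'] by auto
    moreover have "degree \<tau>' = degree (\<tau>' - \<tau>' mod \<tau>)"
      using degree_add_eq_left[of "- (\<tau>' mod \<tau>)" \<tau>'] calculation by simp
    ultimately show ?thesis by (simp add: minus_mod_eq_div_mult)
  qed
  ultimately show "\<tau>' div \<tau> \<noteq> 0" by auto
  then show "0 < degree (\<tau>' div \<tau>)"
    using \<open>degree \<tau>' = _\<close> less \<open>\<tau> \<noteq> 0\<close> by (simp add: degree_mult_eq)
qed

lemma euclid_inv_step:
  assumes inv: "euclid_inv t S (\<sigma>', \<tau>', \<sigma>, \<tau>)" and "\<tau> \<noteq> 0"
  shows "euclid_inv t S (euclid_step (\<sigma>', \<tau>', \<sigma>, \<tau>))"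
proof -
  let ?q = "\<tau>' div \<tau>"
  have mod: "\<tau>' mod \<tau> = \<tau>' - ?q * \<tau>"
    by (simp add: minus_div_mult_eq_mod)
  from inv obtain \<epsilon> where \<epsilon>: "\<epsilon> \<noteq> 0" "\<tau>' * \<sigma> - \<tau> * \<sigma>' = monom \<epsilon> t"
    and dvd: "monom 1 t dvd S * \<sigma>' - \<tau>'" "monom 1 t dvd S * \<sigma> - \<tau>"
    and \<sigma>: "\<sigma> \<noteq> 0" "\<sigma>' = 0 \<or> degree \<sigma>' < degree \<sigma>"
    by (auto simp: euclid_inv_def)
  have "S * (\<sigma>' - ?q * \<sigma>) - \<tau>' mod \<tau> = (S * \<sigma>' - \<tau>') - ?q * (S * \<sigma> - \<tau>)"
    unfolding mod by (simp add: algebra_simps)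
  then have "monom 1 t dvd S * (\<sigma>' - ?q * \<sigma>) - \<tau>' mod \<tau>"
    using dvd by (simp add: dvd_diff)
  moreover have "\<tau> * (\<sigma>' - ?q * \<sigma>) - (\<tau>' mod \<tau>) * \<sigma> = monom (- \<epsilon>) t"
    unfolding mod minus_monom[symmetric] \<epsilon>(2)[symmetric] by (simp add: algebra_simps)
  moreover have "degree \<sigma> < degree (\<sigma>' - ?q * \<sigma>)"
  proof -
    have "degree (?q * \<sigma>) = degree ?q + degree \<sigma>"
      using degree_euclid_quotient(1)[OF assms] \<sigma>(1) by (rule degree_mult_eq)
    then have big: "degree \<sigma> < degree (?q * \<sigma>)"
      using degree_euclid_quotient(2)[OF assms] by simp
    then have "degree \<sigma>' < degree (?q * \<sigma>)"
      using \<sigma>(2) by auto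
    then have "degree (\<sigma>' + - (?q * \<sigma>)) = degree (- (?q * \<sigma>))"
      by (intro degree_add_eq_right) simp
    with big show ?thesis by simp
  qed
  moreover from this have "\<sigma>' - ?q * \<sigma> \<noteq> 0" by auto
  ultimately show ?thesis
    using dvd(2) \<open>\<tau> \<noteq> 0\<close> \<epsilon>(1) degree_mod_less[OF \<open>\<tau> \<noteq> 0\<close>, of \<tau>']
    by (auto simp: euclid_inv_def euclid_step_def)
qed

text \<open>In the determinant the product \<tau>' \<sigma> strictly dominates, and the determinant
  has degree t.\<close>

lemma degree_euclid_inv:
  assumes "euclid_inv t S (\<sigma>', \<tau>', \<sigma>, \<tau>)"
  shows "degree \<tau>' + degree \<sigma> = t"
proof -
  from assms obtain \<epsilon> where \<epsilon>: "\<epsilon> \<noteq> 0" "\<tau>' * \<sigma> - \<tau> * \<sigma>' = monom \<epsilon> t"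
    and nz: "\<sigma> \<noteq> 0" "\<tau>' \<noteq> 0"
    and less: "\<sigma>' = 0 \<or> degree \<sigma>' < degree \<sigma>" "\<tau> = 0 \<or> degree \<tau> < degree \<tau>'"
    by (auto simp: euclid_inv_def)
  have "degree (\<tau>' * \<sigma> - \<tau> * \<sigma>') = degree (\<tau>' * \<sigma>)"
  proof (cases "\<tau> = 0 \<or> \<sigma>' = 0")
    case False
    then have "degree (- (\<tau> * \<sigma>')) < degree (\<tau>' * \<sigma>)"
      using less nz by (simp add: degree_mult_eq add_less_mono)
    from degree_add_eq_left[OF this] show ?thesis by simp
  qed auto
  then show ?thesis
    using \<epsilon> nz by (simp add: degree_mult_eq degree_monom_eq)
qed

text \<open>
  The rows \<open>(\<sigma>', \<tau>')\<close> and \<open>(\<sigma>, \<tau>)\<close> form a basis of the module of solutions of the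
  congruence; the coefficients of \<open>(s, q)\<close> are given by Cramer's rule.
\<close>

lemma euclid_inv_solution:
  assumes inv: "euclid_inv t S (\<sigma>', \<tau>', \<sigma>, \<tau>)" and sol: "monom 1 t dvd S * s - q"
  obtains A B \<epsilon> where "\<epsilon> \<noteq> 0" "A * monom 1 t = q * \<sigma> - \<tau> * s"
    "smult \<epsilon> s = A * \<sigma>' + B * \<sigma>" "smult \<epsilon> q = A * \<tau>' + B * \<tau>"
proof -
  let ?X = "monom (1::'a) t"
  from inv obtain \<epsilon> where \<epsilon>: "\<epsilon> \<noteq> 0" "\<tau>' * \<sigma> - \<tau> * \<sigma>' = monom \<epsilon> t"
    and dvd: "?X dvd S * \<sigma>' - \<tau>'" "?X dvd S * \<sigma> - \<tau>"
    by (auto simp: euclid_inv_def)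
  have X: "monom \<epsilon> t = smult \<epsilon> ?X" by (simp add: smult_monom)
  \<comment> \<open>S cancels here, which exhibits the Cramer numerator as a combination of two
    multiples of x^t.\<close>
  have "q * \<sigma> - \<tau> * s = s * (S * \<sigma> - \<tau>) - \<sigma> * (S * s - q)"
    by (simp add: algebra_simps)
  then have "?X dvd q * \<sigma> - \<tau> * s"
    using dvd sol by (simp add: dvd_diff)
  then obtain A where A: "q * \<sigma> - \<tau> * s = A * ?X"
    by (auto elim!: dvdE simp: mult.commute)
  have "\<tau>' * s - q * \<sigma>' = \<sigma>' * (S * s - q) - s * (S * \<sigma>' - \<tau>')"
    by (simp add: algebra_simps)
  then have "?X dvd \<tau>' * s - q * \<sigma>'"
    using dvd sol by (simp add: dvd_diff)
  then obtain B where B: "\<tau>' * s - q * \<sigma>' = B * ?X"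
    by (auto elim!: dvdE simp: mult.commute)
  have nz: "?X \<noteq> 0" by simp
  have "?X * (A * \<sigma>' + B * \<sigma>) = (A * ?X) * \<sigma>' + (B * ?X) * \<sigma>"
    by (simp add: algebra_simps)
  also have "\<dots> = s * (\<tau>' * \<sigma> - \<tau> * \<sigma>')"
    unfolding A[symmetric] B[symmetric] by (simp add: algebra_simps)
  also have "\<dots> = ?X * smult \<epsilon> s"
    unfolding \<epsilon>(2) X by (simp add: mult.commute)
  finally have 1: "smult \<epsilon> s = A * \<sigma>' + B * \<sigma>"
    using nz by (metis mult_left_cancel)
  have "?X * (A * \<tau>' + B * \<tau>) = (A * ?X) * \<tau>' + (B * ?X) * \<tau>"
    by (simp add: algebra_simps)
  also have "\<dots> = q * (\<tau>' * \<sigma> - \<tau> * \<sigma>')"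
    unfolding A[symmetric] B[symmetric] by (simp add: algebra_simps)
  also have "\<dots> = ?X * smult \<epsilon> q"
    unfolding \<epsilon>(2) X by (simp add: mult.commute)
  finally have 2: "smult \<epsilon> q = A * \<tau>' + B * \<tau>"
    using nz by (metis mult_left_cancel)
  show ?thesis using that[OF \<epsilon>(1) A[symmetric] 1 2] .
qed

lemma degree_diff_mult_le:
  fixes p q r s :: "'a::field poly"
  assumes "degree p + degree q \<le> k" "degree r + degree s \<le> k"
  shows "degree (p * q - r * s) \<le> k"
  by (intro degree_diff_le order.trans[OF degree_mult_le] assms)

lemma mult_monom_degree_less:
  assumes "degree (A * monom (1::'a::field) t) < t"
  shows "A = 0"
  using assms by (cases "A = 0") (auto simp: degree_mult_eq degree_monom_eq)

text \<open>The numerator of A is a multiple of x^t of degree below t, so A = 0. Then B divides both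
  s and q, and coprimality makes it a constant.\<close>

lemma euclid_solution_small:
  assumes inv: "euclid_inv t S (\<sigma>', \<tau>', \<sigma>, \<tau>)" and sol: "monom 1 t dvd S * s - q"
    and cop: "coprime s q" and deg: "degree s \<le> t div 2" "degree q \<le> t div 2"
    and small: "degree \<sigma> < t div 2" "degree \<tau> < t div 2"
  obtains c where "c \<noteq> 0" "\<sigma> = smult c s" "\<tau> = smult c q"
proof -
  from euclid_inv_solution[OF inv sol] obtain A B \<epsilon> where
    \<epsilon>: "\<epsilon> \<noteq> 0" and A: "A * monom 1 t = q * \<sigma> - \<tau> * s" and
    s: "smult \<epsilon> s = A * \<sigma>' + B * \<sigma>" and q: "smult \<epsilon> q = A * \<tau>' + B * \<tau>" by metis
  have "degree (q * \<sigma> - \<tau> * s) \<le> t - 1"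
    using deg small by (intro degree_diff_mult_le) linarith+
  then have "A = 0"
    using small A by (intro mult_monom_degree_less[of A t]) auto
  then have "B dvd s" "B dvd q"
    using s q \<epsilon> by (metis add_0 mult_zero_left dvd_triv_left dvd_smult_cancel)+
  with cop have "is_unit B" by (metis coprime_common_divisor)
  moreover from this have "B \<noteq> 0" by auto
  ultimately obtain b where b: "B = [:b:]" "b \<noteq> 0"
    by (metis is_unit_iff_degree degree_eq_zeroE pCons_0_0)
  show ?thesis
  proof
    show "\<epsilon> / b \<noteq> 0" using \<epsilon> b by simp
    show "\<sigma> = smult (\<epsilon> / b) s" "\<tau> = smult (\<epsilon> / b) q"
      using arg_cong[OF s, of "smult (inverse b)"] arg_cong[OF q, of "smult (inverse b)"] b \<open>A = 0\<close>
      by (simp_all add: divide_inverse mult.commute)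
  qed
qed

text \<open>Now the numerator of A may reach degree t, so A is only a constant; comparing degrees in
  s = A \<sigma>' + B \<sigma>, up to the factor \<epsilon>, makes B constant too.\<close>

lemma euclid_solution_half:
  assumes inv: "euclid_inv t S (\<sigma>', \<tau>', \<sigma>, \<tau>)" and sol: "monom 1 t dvd S * s - q"
    and "s \<noteq> 0" and t: "even t" "0 < t" and deg: "degree s \<le> t div 2" "degree q \<le> degree s"
    and half: "degree \<sigma> = t div 2" "degree \<tau> < t div 2"
  obtains c lam where "c \<noteq> 0" "smult lam \<sigma>' + \<sigma> = smult c s" "smult lam \<tau>' + \<tau> = smult c q"
proof -
  from euclid_inv_solution[OF inv sol] obtain A B \<epsilon> where
    \<epsilon>: "\<epsilon> \<noteq> 0" and A: "A * monom 1 t = q * \<sigma> - \<tau> * s" and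
    s: "smult \<epsilon> s = A * \<sigma>' + B * \<sigma>" and q: "smult \<epsilon> q = A * \<tau>' + B * \<tau>" by metis
  from inv have less: "\<sigma>' = 0 \<or> degree \<sigma>' < degree \<sigma>" "\<sigma> \<noteq> 0" "\<tau>' \<noteq> 0"
    by (auto simp: euclid_inv_def)
  have deg\<tau>': "degree \<tau>' = t div 2"
    using degree_euclid_inv[OF inv] half t by (auto elim!: evenE)
  have "degree (q * \<sigma> - \<tau> * s) \<le> t"
    using deg half by (intro degree_diff_mult_le) linarith+
  then have "degree A = 0"
    unfolding A[symmetric] by (cases "A = 0") (auto simp: degree_mult_eq degree_monom_eq)
  then obtain a where a: "A = [:a:]" by (rule degree_eq_zeroE)
  have "degree (B * \<sigma>) \<le> t div 2"
  proof -
    have "B * \<sigma> = smult \<epsilon> s - smult a \<sigma>'"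
      using s a by simp
    moreover have "degree (smult \<epsilon> s - smult a \<sigma>') \<le> t div 2"
      using deg less half by (intro degree_diff_le order.trans[OF degree_smult_le]) auto
    ultimately show ?thesis by simp
  qed
  then have "degree B = 0"
    using half less by (cases "B = 0") (auto simp: degree_mult_eq)
  then obtain b where b: "B = [:b:]" by (rule degree_eq_zeroE)
  \<comment> \<open>Otherwise (s, q) is proportional to (\<sigma>', \<tau>'), where deg \<sigma>' <
    t/2 = deg \<tau>', against deg q \<le> deg s.\<close>
  have "b \<noteq> 0"
  proof
    assume "b = 0"
    then have s': "smult \<epsilon> s = smult a \<sigma>'" and q': "smult \<epsilon> q = smult a \<tau>'"
      using s q a b by auto
    then have "a \<noteq> 0" "\<sigma>' \<noteq> 0"
      using \<epsilon> \<open>s \<noteq> 0\<close> by auto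
    moreover from this have "degree s = degree \<sigma>'" "degree q = degree \<tau>'"
      using arg_cong[OF s', of degree] arg_cong[OF q', of degree] \<epsilon> by auto
    ultimately show False
      using deg half less deg\<tau>' by auto
  qed
  show ?thesis
  proof
    show "\<epsilon> / b \<noteq> 0" using \<epsilon> \<open>b \<noteq> 0\<close> by simp
    have "smult (inverse b) (smult \<epsilon> s) = smult (inverse b) (smult a \<sigma>' + smult b \<sigma>)"
      "smult (inverse b) (smult \<epsilon> q) = smult (inverse b) (smult a \<tau>' + smult b \<tau>)"
      using s q a b by auto
    then show "smult (a / b) \<sigma>' + \<sigma> = smult (\<epsilon> / b) s" "smult (a / b) \<tau>' + \<tau> = smult (\<epsilon> / b) q"
      using \<open>b \<noteq> 0\<close> by (simp_all add: smult_add_right divide_inverse mult.commute)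
  qed
qed

section \<open>The indexed sequences as iterates of one step\<close>

lemma extended_euclid_state:
  assumes eu: "extended_euclid (monom 1 t) S \<sigma> \<tau> m" and "int k \<le> m + 1"
  shows "(euclid_step ^^ k) (0, monom 1 t, 1, S) =
    (\<sigma> (int k - 1), \<tau> (int k - 1), \<sigma> (int k), \<tau> (int k))"
  using assms(2)
proof (induction k)
  case 0
  then show ?case using eu by (simp add: extended_euclid_def)
next
  case (Suc k)
  then have "int (Suc k) \<in> {1..m+1}" by simp
  with eu have "\<tau> (int (Suc k)) = \<tau> (int (Suc k) - 2) mod \<tau> (int (Suc k) - 1) \<and>
      \<sigma> (int (Suc k)) = \<sigma> (int (Suc k) - 2) - (\<tau> (int (Suc k) - 2) div \<tau> (int (Suc k) - 1)) * \<sigma> (int (Suc k) - 1)"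
    unfolding extended_euclid_def by blast
  moreover have "int (Suc k) - 2 = int k - 1" "int (Suc k) - 1 = int k" by auto
  ultimately show ?case
    using Suc by (simp add: euclid_step_def)
qed

lemma extended_euclid_inv:
  assumes eu: "extended_euclid (monom 1 t) S \<sigma> \<tau> m" and "degree S < t" and "int k \<le> m + 1"
  shows "euclid_inv t S (\<sigma> (int k - 1), \<tau> (int k - 1), \<sigma> (int k), \<tau> (int k))"
  unfolding extended_euclid_state[OF eu assms(3), symmetric]
  using assms(3)
proof (induction k)
  case 0
  then show ?case using euclid_inv_init[OF assms(2)] by simp
next
  case (Suc k)
  have "\<tau> (int k) \<noteq> 0"
    using eu Suc.prems by (auto simp: extended_euclid_def)
  moreover have "euclid_inv t S ((euclid_step ^^ k) (0, monom 1 t, 1, S))"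
    using Suc by simp
  ultimately show ?case
    using Suc.prems by (simp add: extended_euclid_state[OF eu] euclid_inv_step)
qed

text \<open>The loop starts after one step and first tests \<tau>_1. Hence h must be positive, and h
  - 1 further steps are made.\<close>

lemma euclid_loop_eq_state:
  fixes h :: nat
  assumes eu: "extended_euclid (monom 1 t) S \<sigma> \<tau> m" and h: "0 < h" "int h \<le> m + 1"
    and stop: "degree (\<tau> (int h)) < t div 2"
    and least: "\<And>i. i < h \<Longrightarrow> \<not> degree (\<tau> (int i)) < t div 2"
  shows "euclid_loop t S = Some (\<sigma> (int h - 1), \<tau> (int h - 1), \<sigma> (int h), \<tau> (int h))"
proof -
  let ?s = "(0, monom 1 t, 1, S)"
  let ?b = "\<lambda>(\<sigma>' :: 'a poly, \<tau>' :: 'a poly, \<sigma> :: 'a poly, \<tau> :: 'a poly). \<not> degree \<tau> < t div 2"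
  have state: "(euclid_step ^^ k) (euclid_step ?s) =
      (\<sigma> (int (Suc k) - 1), \<tau> (int (Suc k) - 1), \<sigma> (int (Suc k)), \<tau> (int (Suc k)))"
    if "k < h" for k
    using extended_euclid_state[OF eu, of "Suc k"] that h
    by (simp add: funpow_swap1)
  have stop_state: "\<not> ?b ((euclid_step ^^ (h - 1)) (euclid_step ?s))"
    using state[of "h - 1"] h stop by simp
  then have ex: "\<exists>k. \<not> ?b ((euclid_step ^^ k) (euclid_step ?s))" by (rule exI)
  have before: "?b ((euclid_step ^^ k) (euclid_step ?s))" if "k < h - 1" for k
    using state[of k] least[of "Suc k"] that by simp
  have "(LEAST k. \<not> ?b ((euclid_step ^^ k) (euclid_step ?s))) = h - 1"
    using before stop_state by (intro Least_equality) (meson not_less)+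
  then show ?thesis
    unfolding euclid_loop_def while_option_def if_P[OF ex] using state[of "h - 1"] h by simp
qed

text \<open>Division by zero turns the start into (1, 0, 0, x^t), which fails the test; one more
  step restores (0, x^t, 1, 0), which passes.\<close>

lemma euclid_loop_0:
  fixes t :: nat
  assumes "2 \<le> t"
  shows "euclid_loop t 0 = Some (0, monom 1 t, 1, 0 :: 'a::field poly)"
proof -
  have "0 < t div 2" "\<not> t < t div 2" using assms by auto
  then show ?thesis
    unfolding euclid_loop_def
    by (subst while_option_unfold)
      (simp add: euclid_step_def degree_monom_eq, subst while_option_unfold, simp)
qed

section \<open>Decoding\<close>

lemma hamming_dist_triangle:
  fixes x y z :: "'a ^ 'n"
  shows "hamming_dist x z \<le> hamming_dist x y + hamming_dist y z"
proof -
  have "hamming_dist x z \<le> card ({i. x $ i \<noteq> y $ i} \<union> {i. y $ i \<noteq> z $ i})"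
    unfolding hamming_dist_def by (intro card_mono) auto
  also have "\<dots> \<le> hamming_dist x y + hamming_dist y z"
    unfolding hamming_dist_def by (rule card_Un_le)
  finally show ?thesis .
qed

lemma hamming_dist_commute: "hamming_dist x y = hamming_dist y x"
  unfolding hamming_dist_def by (metis (mono_tags, lifting))

lemma min_distance_le:
  assumes "x \<in> C" "y \<in> C" "x \<noteq> y"
  shows "min_distance C \<le> hamming_dist x y"
  unfolding min_distance_def by (rule cInf_lower) (use assms in auto)

text \<open>By the triangle inequality, any other codeword is at least as far from c + e as c
  is.\<close>

lemma dist_to_code_eq_card_support:
  fixes c e :: "('a::field) ^ 'n"
  assumes "c \<in> C" and "2 * card (support e) \<le> min_distance C"
  shows "dist_to_code (c + e) C = card (support e)"
proof -
  have dist: "hamming_dist (c + e) c = card (support e)"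
    by (simp add: hamming_dist_def support_def)
  have "card (support e) \<le> hamming_dist (c + e) c'" if "c' \<in> C" for c'
  proof (cases "c' = c")
    case True
    then show ?thesis by (simp add: dist)
  next
    case False
    then have "2 * card (support e) \<le> hamming_dist c (c + e) + hamming_dist (c + e) c'"
      using assms min_distance_le[of c C c'] that hamming_dist_triangle[of c c' "c + e"] by auto
    then show ?thesis
      using dist hamming_dist_commute[of c "c + e"] by simp
  qed
  with assms(1) dist show ?thesis
    unfolding dist_to_code_def by (intro cInf_eq_minimum) (auto intro!: image_eqI)
qed

lemma syndrome_add: "syndrome H (x + y) k = syndrome H x k + syndrome H y k"
  by (simp add: syndrome_def algebra_simps sum.distrib)

lemma syndrome_diff: "syndrome H (x - y) k = syndrome H x k - syndrome H y k"
  by (simp add: syndrome_def algebra_simps sum_subtractf)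

lemma coeff_syndrome_poly: "coeff (syndrome_poly t s) k = (if k < t then s (t - 1 - k) else 0)"
  by (simp add: syndrome_poly_def coeff_sum)

lemma syndrome_poly_eq_iff: "syndrome_poly t s = syndrome_poly t s' \<longleftrightarrow> (\<forall>k<t. s k = s' k)"
proof
  assume eq: "syndrome_poly t s = syndrome_poly t s'"
  show "\<forall>k<t. s k = s' k"
  proof safe
    fix k assume "k < t"
    then show "s k = s' k"
      using arg_cong[OF eq, of "\<lambda>p. coeff p (t - 1 - k)"] by (simp add: coeff_syndrome_poly)
  qed
next
  assume "\<forall>k<t. s k = s' k"
  then show "syndrome_poly t s = syndrome_poly t s'"
    by (auto simp: syndrome_poly_def intro!: sum.cong)
qed

text \<open>Since q(0) is nonzero, every factor x of the product comes from p; the induction strips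
  them one by one.\<close>

lemma monom_dvd_mult_cancel:
  fixes p q :: "'a::field poly"
  assumes "monom 1 t dvd p * q" and "poly q 0 \<noteq> 0"
  shows "monom 1 t dvd p"
  using assms(1)
proof (induction t arbitrary: p)
  case 0
  then show ?case by (simp add: monom_0 pCons_one)
next
  case (Suc t)
  then obtain r where r: "p * q = monom 1 (Suc t) * r" by (auto elim: dvdE)
  then have "poly p 0 * poly q 0 = 0"
    by (metis poly_mult poly_monom mult_zero_left mult_zero_right power_0_Suc)
  then have "[:0, 1:] dvd p"
    using assms(2) poly_eq_0_iff_dvd[of p 0] by simp
  then obtain p' where p': "p = [:0, 1:] * p'" by (auto elim: dvdE)
  have "[:0, 1:] * (p' * q) = [:0, 1:] * (monom 1 t * r)"
    using r p' by (simp add: monom_Suc)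
  then have "p' * q = monom 1 t * r"
    by (metis mult_left_cancel pCons_eq_0_iff zero_neq_one)
  then have "monom 1 t dvd p'"
    using Suc.IH by simp
  then show ?case
  proof (rule dvdE)
    fix k assume "p' = monom 1 t * k"
    then have "p = monom 1 (Suc t) * k"
      using p' by (simp add: monom_Suc)
    then show "monom 1 (Suc t) dvd p" by simp
  qed
qed

text \<open>Both syndrome polynomials solve the same congruence, and \<sigma>(0) is nonzero because
  the roots of \<sigma> are nonzero points. So x^t divides their difference, which has degree below
  t.\<close>

lemma evaluator_locator_unique:
  fixes \<alpha> :: "('a::field) ^ 'n"
  assumes "0 < t" "\<forall>i. \<alpha> $ i \<noteq> 0" and "support e \<subseteq> root_set \<alpha> \<sigma>"
    and \<sigma>: "\<sigma> \<noteq> 0" "degree \<sigma> = card (root_set \<alpha> \<sigma>)" and inj: "inj (\<lambda>i. \<alpha> $ i)"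
    and sol: "monom 1 t dvd S * \<sigma> - evaluator t \<alpha> w f \<sigma> e" and "degree S < t"
  shows "S = syndrome_poly t (syndrome (parity_check t \<alpha> w f) e)" (is "_ = ?S")
proof (rule ccontr)
  assume "S \<noteq> ?S"
  have "monom 1 t dvd ?S * \<sigma> - evaluator t \<alpha> w f \<sigma> e"
    using evaluator_cong[OF assms(1,3)] by (simp add: cong_iff_dvd_diff)
  from dvd_diff[OF sol this] have "monom 1 t dvd (S - ?S) * \<sigma>"
    by (simp add: algebra_simps)
  moreover have "poly \<sigma> 0 \<noteq> 0"
    using assms(2) \<sigma>(1) by (subst locator_eq_prod[OF inj \<sigma>(2)]) (auto simp: poly_prod)
  ultimately have "monom 1 t dvd S - ?S"
    by (rule monom_dvd_mult_cancel)
  moreover have "S - ?S \<noteq> 0"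
    using \<open>S \<noteq> ?S\<close> by simp
  ultimately have "t \<le> degree (S - ?S)"
    using dvd_imp_degree_le[of "monom 1 t" "S - ?S"] by (simp add: degree_monom_eq)
  moreover have "degree (S - ?S) < t"
    using assms(8) degree_syndrome_poly[OF assms(1)] by (rule degree_diff_less)
  ultimately show False by simp
qed

section \<open>Frequencies as numbers of roots\<close>

text \<open>Where \<sigma>' vanishes, \<sigma> does not, so no combination has a root there; this
  matches the value \<infinity>.\<close>

lemma beta_eq_Some_iff:
  assumes "\<not> (poly \<sigma>' (\<alpha> $ i) = 0 \<and> poly \<sigma> (\<alpha> $ i) = 0)"
  shows "beta \<alpha> \<sigma>' \<sigma> i = Some x \<longleftrightarrow> i \<in> root_set \<alpha> (smult x \<sigma>' + \<sigma>)"
proof (cases "poly \<sigma>' (\<alpha> $ i) = 0")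
  case True
  then show ?thesis
    using assms by (simp add: beta_def root_set_def)
next
  case False
  then have "- (inverse (poly \<sigma>' (\<alpha> $ i)) * poly \<sigma> (\<alpha> $ i)) = x \<longleftrightarrow>
      - poly \<sigma> (\<alpha> $ i) = x * poly \<sigma>' (\<alpha> $ i)"
    by (simp add: nonzero_divide_eq_eq[symmetric] divide_inverse mult.commute)
  also have "\<dots> \<longleftrightarrow> x * poly \<sigma>' (\<alpha> $ i) + poly \<sigma> (\<alpha> $ i) = 0"
    by (metis add.commute add_eq_0_iff)
  finally show ?thesis
    using False by (simp add: beta_def root_set_def)
qed

lemma frequency_beta:
  assumes "\<And>i. \<not> (poly \<sigma>' (\<alpha> $ i) = 0 \<and> poly \<sigma> (\<alpha> $ i) = 0)"
  shows "frequency (beta \<alpha> \<sigma>' \<sigma>) x = card (root_set \<alpha> (smult x \<sigma>' + \<sigma>))"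
  using assms by (simp add: frequency_def beta_eq_Some_iff)

text \<open>Every combination has the degree of \<sigma>, which bounds its number of roots. The
  bound is attained at \<open>lam\<close>, so it is the maximal frequency.\<close>

lemma most_frequent_beta:
  fixes \<alpha> :: "('a::field) ^ 'n"
  assumes inj: "inj (\<lambda>i. \<alpha> $ i)"
    and nz: "\<And>i. \<not> (poly \<sigma>' (\<alpha> $ i) = 0 \<and> poly \<sigma> (\<alpha> $ i) = 0)"
    and deg: "\<sigma>' = 0 \<or> degree \<sigma>' < degree \<sigma>" "0 < degree \<sigma>"
    and lam: "card (root_set \<alpha> (smult lam \<sigma>' + \<sigma>)) = degree \<sigma>"
  shows "x \<in> most_frequent (beta \<alpha> \<sigma>' \<sigma>) \<longleftrightarrow> card (root_set \<alpha> (smult x \<sigma>' + \<sigma>)) = degree \<sigma>"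
proof -
  have le: "card (root_set \<alpha> (smult y \<sigma>' + \<sigma>)) \<le> degree \<sigma>" for y
  proof -
    have "degree (smult y \<sigma>' + \<sigma>) = degree \<sigma>"
      using deg by (auto intro!: degree_add_eq_right le_less_trans[OF degree_smult_le])
    moreover from this have "smult y \<sigma>' + \<sigma> \<noteq> 0"
      using deg(2) by auto
    ultimately show ?thesis
      using card_root_set_le[OF inj] by metis
  qed
  have range: "Some y \<in> range (beta \<alpha> \<sigma>' \<sigma>)" if "card (root_set \<alpha> (smult y \<sigma>' + \<sigma>)) = degree \<sigma>" for y
  proof -
    from that deg(2) obtain i where "i \<in> root_set \<alpha> (smult y \<sigma>' + \<sigma>)"
      by (metis card.empty equals0I less_irrefl)
    then have "beta \<alpha> \<sigma>' \<sigma> i = Some y"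
      using nz by (simp add: beta_eq_Some_iff)
    then show ?thesis by (metis rangeI)
  qed
  show ?thesis
    unfolding most_frequent_def frequency_beta[OF nz] mem_Collect_eq
    using le range lam by (metis le_antisym)
qed

text \<open>A common zero would be a zero of the determinant, a nonzero multiple of x^t.\<close>

lemma euclid_inv_no_common_zero:
  fixes x :: "'a::field"
  assumes "euclid_inv t S (\<sigma>', \<tau>', \<sigma>, \<tau>)" and "x \<noteq> 0"
  shows "\<not> (poly \<sigma>' x = 0 \<and> poly \<sigma> x = 0)"
proof
  assume zero: "poly \<sigma>' x = 0 \<and> poly \<sigma> x = 0"
  from assms(1) obtain \<epsilon> where "\<epsilon> \<noteq> 0" "\<tau>' * \<sigma> - \<tau> * \<sigma>' = monom \<epsilon> t"
    by (auto simp: euclid_inv_def)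
  with zero have "poly (monom \<epsilon> t) x = 0"
    by (metis poly_diff poly_mult mult_zero_right diff_self)
  with \<open>\<epsilon> \<noteq> 0\<close> assms(2) show False
    by (simp add: poly_monom)
qed

lemma key_equation_evaluator:
  fixes \<alpha> :: "('a::field) ^ 'n"
  assumes "inj (\<lambda>i. \<alpha> $ i)" and "\<forall>i. \<alpha> $ i \<noteq> 0" and "\<forall>i. w $ i \<noteq> 0" and "0 < t"
    and "\<sigma> \<noteq> 0" and roots: "root_set \<alpha> \<sigma> = support e" and deg: "degree \<sigma> = card (support e)"
    and "card (support e) \<le> t div 2"
  shows "key_equation t (syndrome_poly t (syndrome (parity_check t \<alpha> w f) e)) (support e)
    \<sigma> (evaluator t \<alpha> w f \<sigma> e)"
  unfolding key_equation_def
proof (intro conjI)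
  show "degree (evaluator t \<alpha> w f \<sigma> e) \<le> degree \<sigma>"
    by (rule degree_evaluator_le) fact
  show "coprime \<sigma> (evaluator t \<alpha> w f \<sigma> e)"
    using assms by (intro coprime_evaluator) auto
  show "[syndrome_poly t (syndrome (parity_check t \<alpha> w f) e) * \<sigma> = evaluator t \<alpha> w f \<sigma> e]
      (mod monom 1 t)"
    using assms by (intro evaluator_cong) auto
qed fact+

lemma locator_condition_evaluator:
  fixes \<alpha> :: "('a::field) ^ 'n"
  assumes "inj (\<lambda>i. \<alpha> $ i)" and "\<forall>i. \<alpha> $ i \<noteq> 0" and "\<forall>i. w $ i \<noteq> 0"
    and "\<sigma> \<noteq> 0" and "root_set \<alpha> \<sigma> = support e" and "degree \<sigma> = card (support e)"
  shows "locator_condition t \<alpha> w f \<sigma> (evaluator t \<alpha> w f \<sigma> e)"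
proof -
  have "error_values t \<alpha> w \<sigma> (evaluator t \<alpha> w f \<sigma> e) = e"
    using assms by (intro error_values_evaluator) auto
  moreover have "omega_poly t \<alpha> w \<sigma> e = 0 \<or> degree (omega_poly t \<alpha> w \<sigma> e) < card (support e)"
    using degree_omega_poly[OF assms(4)] assms(6) by metis
  ultimately show ?thesis
    using assms(5,6) by (simp add: locator_condition_def tau_decomposition_def Let_def evaluator_def)
qed

lemma support_error_values: "support (error_values t \<alpha> w \<sigma> \<tau>) \<subseteq> root_set \<alpha> \<sigma>"
  by (auto simp: support_def error_values_def)

text \<open>An element before x may stop the loop first, but it returns the same result.\<close>

lemma try_all_eq_Some:
  assumes "x \<in> set xs" "stop x" and "\<And>y. y \<in> set xs \<Longrightarrow> stop y \<Longrightarrow> err y = z"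
  shows "try_all err stop xs prev = Some z"
  using assms by (induction xs arbitrary: prev) auto

theorem theorem5p5:
  fixes \<alpha> v w c e r :: "('a :: {field, finite}) ^ 'n"
    and \<eta>\<^sub>1 lam\<^sub>1 :: 'a
    and t l :: nat
    and C :: "('a ^ 'n) set"
    and f S :: "'a poly"
    and H :: "nat \<Rightarrow> 'a ^ 'n"
    and \<sigma> \<tau> :: "int \<Rightarrow> 'a poly"
    and m h :: int
  assumes "inj (\<lambda>i. \<alpha> $ i)" and "\<forall>i. \<alpha> $ i \<noteq> 0" and "\<forall>i. v $ i \<noteq> 0"
    and "t \<ge> 2" and "even t" and "t \<le> CARD('n)" and "l < CARD('n) - t"
    and "\<not> (\<eta>\<^sub>1 = 0 \<and> lam\<^sub>1 = 0)"
    and "C = TGRS (CARD('n) - t) \<alpha> v l \<eta>\<^sub>1 lam\<^sub>1"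
    and "MDS_code C (CARD('n) - t) (t + 1)"
    and "w = w_vec \<alpha> v" and "f = f_poly t \<alpha> l \<eta>\<^sub>1 lam\<^sub>1" and "H = parity_check t \<alpha> w f"
    and "dist_to_code r C \<le> t div 2"
    and "r = c + e" and "c \<in> C" and "card (support e) \<le> t div 2"
    and "S = syndrome_poly t (syndrome H r)"
    and "extended_euclid (monom 1 t) S \<sigma> \<tau> m"
    and "h \<in> {-1..m+1}" and "degree (\<tau> h) < t div 2"
    and "\<forall>i\<in>{-1..m+1}. degree (\<tau> i) < t div 2 \<longrightarrow> h \<le> i"
  shows "(degree (\<sigma> h) < t div 2 \<longrightarrow>
            key_equation t S (support e) (\<sigma> h) (\<tau> h) \<and> dist_to_code r C < t div 2)
       \<and> (degree (\<sigma> h) = t div 2 \<longrightarrow>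
            (\<exists>lam.
               key_equation t S (support e)
                 (smult lam (\<sigma> (h - 1)) + \<sigma> h) (smult lam (\<tau> (h - 1)) + \<tau> h) \<and>
               locator_condition t \<alpha> w f
                 (smult lam (\<sigma> (h - 1)) + \<sigma> h) (smult lam (\<tau> (h - 1)) + \<tau> h) \<and>
               lam \<in> most_frequent (beta \<alpha> (\<sigma> (h - 1)) (\<sigma> h))) \<and>
            dist_to_code r C = t div 2)
       \<and> (\<forall>enum :: 'a set \<Rightarrow> 'a list.
            (\<forall>A. distinct (enum A) \<and> set (enum A) = A) \<longrightarrow>
            algorithm_B enum t \<alpha> w f H r = Some (e, c))"
proof -
  note inj = assms(1) and \<alpha> = assms(2) and v = assms(3) and l = assms(7) and C = assms(9)
    and f = assms(12) and H = assms(13) and r = assms(15) and c = assms(16)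
    and e_le = assms(17) and S = assms(18) and eu = assms(19) and h = assms(20)
    and h_less = assms(21) and h_min = assms(22)
  define J where "J = support e"
  have t: "0 < t" "0 < t div 2" "t div 2 < t" "t div 2 + t div 2 = t"
    using assms(4,5) by (auto elim!: evenE)
  have w: "\<forall>i. w $ i \<noteq> 0"
    using v u_vec_nonzero[OF inj] by (simp add: assms(11) w_vec_def)
  have min_dist: "min_distance C = t + 1"
    using assms(10) by (simp add: MDS_code_def linear_code_def)
  have dist: "dist_to_code r C = card J"
    unfolding r J_def using c e_le min_dist by (intro dist_to_code_eq_card_support) auto

  \<comment> \<open>Syndromes determine error words of weight at most t/2\<close>
  have kernel: "x \<in> C \<longleftrightarrow> (\<forall>k<t. syndrome H x k = 0)" for x
    unfolding C H f assms(11) by (rule parity_check_TGRS[OF inj v t(1) l assms(8)])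
  have S_e: "S = syndrome_poly t (syndrome H e)"
    unfolding S syndrome_poly_eq_iff r using c by (simp add: syndrome_add kernel)
  have deg_S: "degree S < t"
    unfolding S using t(1) by (rule degree_syndrome_poly)
  \<comment> \<open>Two such words with one syndrome differ by a codeword of weight at most t, below
    the minimum distance t + 1.\<close>
  have word_eq: "x = e"
    if "S = syndrome_poly t (syndrome H x)" and card: "card (support x) \<le> t div 2" for x
  proof (rule ccontr)
    assume "x \<noteq> e"
    have "x - e \<in> C"
      using that(1) unfolding S_e syndrome_poly_eq_iff kernel by (simp add: syndrome_diff)
    moreover have "0 \<in> C"
      by (simp add: kernel syndrome_def)
    ultimately have "t + 1 \<le> hamming_dist (x - e) 0"
      using min_distance_le[of "x - e" C 0] \<open>x \<noteq> e\<close> min_dist by simp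
    also have "\<dots> \<le> card (support x \<union> support e)"
      unfolding hamming_dist_def by (intro card_mono) (auto simp: support_def)
    also have "\<dots> \<le> card (support x) + card (support e)"
      by (rule card_Un_le)
    also have "\<dots> \<le> t"
      using card e_le t(4) by linarith
    finally show False by simp
  qed

  \<comment> \<open>Degrees at the index h\<close>
  have "\<tau> (-1) = monom 1 t"
    using eu by (simp add: extended_euclid_def)
  then have "h \<noteq> -1"
    using h_less t(3) by (auto simp: degree_monom_eq)
  with h have "0 \<le> h" "h \<le> m + 1" by auto
  then obtain k where k: "h = int k" "int k \<le> m + 1"
    by (metis nonneg_int_cases)
  have inv: "euclid_inv t S (\<sigma> (h - 1), \<tau> (h - 1), \<sigma> h, \<tau> h)"
    using extended_euclid_inv[OF eu deg_S k(2)] by (simp add: k(1))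
  \<comment> \<open>Minimality of h bounds deg \<tau>_(h-1) from below; as deg \<tau>_(h-1) + deg
    \<sigma>_h = t, it bounds deg \<sigma>_h from above.\<close>
  have "\<not> degree (\<tau> (h - 1)) < t div 2"
    using h_min k by force
  with degree_euclid_inv[OF inv] t have deg_le: "degree (\<sigma> h) \<le> t div 2"
    by linarith

  \<comment> \<open>The true locator and its position among the Euclidean rows\<close>
  obtain s where s: "s \<noteq> 0" "root_set \<alpha> s = J" "degree s = card J"
    using exists_locator[OF inj] .
  define q where "q = evaluator t \<alpha> w f s e"
  \<comment> \<open>Stated for all nonzero multiples of (s, q), since the rows match this pair only
    up to a scalar.\<close>
  have props: "key_equation t S J \<sigma>' \<tau>'" "locator_condition t \<alpha> w f \<sigma>' \<tau>'"
      "error_values t \<alpha> w \<sigma>' \<tau>' = e" "root_set \<alpha> \<sigma>' = J" "degree \<sigma>' = card J"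
    if "x \<noteq> 0" "\<sigma>' = smult x s" "\<tau>' = smult x q" for x \<sigma>' \<tau>'
  proof -
    have \<sigma>': "\<sigma>' \<noteq> 0" "root_set \<alpha> \<sigma>' = support e" "degree \<sigma>' = card (support e)"
      using s that by (auto simp: root_set_def J_def)
    have \<tau>': "\<tau>' = evaluator t \<alpha> w f \<sigma>' e"
      using that by (simp add: q_def evaluator_smult)
    show "key_equation t S J \<sigma>' \<tau>'"
      unfolding S_e J_def \<tau>' H by (rule key_equation_evaluator[OF inj \<alpha> w t(1) \<sigma>' e_le])
    show "locator_condition t \<alpha> w f \<sigma>' \<tau>'"
      unfolding \<tau>' by (rule locator_condition_evaluator[OF inj \<alpha> w \<sigma>'])
    show "error_values t \<alpha> w \<sigma>' \<tau>' = e"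
      unfolding \<tau>' using \<sigma>' by (intro error_values_evaluator[OF inj \<alpha> w]) auto
    show "root_set \<alpha> \<sigma>' = J" "degree \<sigma>' = card J"
      using \<sigma>' by (simp_all add: J_def)
  qed
  have key: "key_equation t S J s q"
    using props(1)[of 1 s q] by simp
  then have sol: "monom 1 t dvd S * s - q" and cop: "coprime s q"
    and degs: "degree s \<le> t div 2" "degree q \<le> degree s"
    by (auto simp: key_equation_def cong_iff_dvd_diff)

  have small: "\<exists>x. x \<noteq> 0 \<and> \<sigma> h = smult x s \<and> \<tau> h = smult x q" if "degree (\<sigma> h) < t div 2"
    using euclid_solution_small[OF inv sol cop degs(1) order.trans[OF degs(2,1)] that h_less] by metis
  have half: "\<exists>x lam. x \<noteq> 0 \<and> smult lam (\<sigma> (h - 1)) + \<sigma> h = smult x s \<and>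
      smult lam (\<tau> (h - 1)) + \<tau> h = smult x q" if "degree (\<sigma> h) = t div 2"
    using euclid_solution_half[OF inv sol s(1) assms(5) t(1) degs that h_less] by metis

  have deg_comb: "degree (smult y (\<sigma> (h - 1)) + \<sigma> h) = t div 2"
    if "degree (\<sigma> h) = t div 2" for y
  proof -
    have "degree (\<sigma> (h - 1)) < degree (\<sigma> h)"
      using inv t(2) that by (auto simp: euclid_inv_def)
    then show ?thesis
      using that by (subst degree_add_eq_right) (auto intro: le_less_trans[OF degree_smult_le])
  qed
  have most_frequent: "y \<in> most_frequent (beta \<alpha> (\<sigma> (h - 1)) (\<sigma> h)) \<longleftrightarrow>
      card (root_set \<alpha> (smult y (\<sigma> (h - 1)) + \<sigma> h)) = t div 2"
    if eq: "degree (\<sigma> h) = t div 2" for y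
  proof -
    obtain x lam where "x \<noteq> 0" "smult lam (\<sigma> (h - 1)) + \<sigma> h = smult x s"
        "smult lam (\<tau> (h - 1)) + \<tau> h = smult x q"
      using half eq by blast
    from props(4,5)[OF this] have
      "card (root_set \<alpha> (smult lam (\<sigma> (h - 1)) + \<sigma> h)) = degree (\<sigma> h)"
      using deg_comb[OF eq] eq by metis
    moreover have "\<sigma> (h - 1) = 0 \<or> degree (\<sigma> (h - 1)) < degree (\<sigma> h)" "0 < degree (\<sigma> h)"
      using inv eq t(2) by (auto simp: euclid_inv_def)
    ultimately show ?thesis
      using most_frequent_beta[OF inj euclid_inv_no_common_zero[OF inv]] \<alpha> eq by metis
  qed

  have part1: "key_equation t S J (\<sigma> h) (\<tau> h) \<and> dist_to_code r C < t div 2"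
    if less: "degree (\<sigma> h) < t div 2"
  proof -
    obtain x where x: "x \<noteq> 0" "\<sigma> h = smult x s" "\<tau> h = smult x q"
      using small[OF less] by blast
    show ?thesis
      using props(1,5)[OF x] less dist by simp
  qed

  have part2: "\<exists>x lam. x \<noteq> 0 \<and> smult lam (\<sigma> (h - 1)) + \<sigma> h = smult x s \<and>
      smult lam (\<tau> (h - 1)) + \<tau> h = smult x q \<and>
      lam \<in> most_frequent (beta \<alpha> (\<sigma> (h - 1)) (\<sigma> h)) \<and> card J = t div 2"
    if eq: "degree (\<sigma> h) = t div 2"
  proof -
    obtain x lam where x: "x \<noteq> 0" "smult lam (\<sigma> (h - 1)) + \<sigma> h = smult x s"
        "smult lam (\<tau> (h - 1)) + \<tau> h = smult x q"
      using half[OF eq] by blast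
    have "card J = t div 2"
      using props(5)[OF x] deg_comb[OF eq] by simp
    moreover have "lam \<in> most_frequent (beta \<alpha> (\<sigma> (h - 1)) (\<sigma> h))"
      using most_frequent[OF eq] props(4)[OF x] \<open>card J = t div 2\<close> by metis
    ultimately show ?thesis
      using x by blast
  qed

  \<comment> \<open>Correctness of Algorithm B\<close>
  have loop: "euclid_loop t S = Some (\<sigma> (h - 1), \<tau> (h - 1), \<sigma> h, \<tau> h)"
  proof (cases "k = 0")
    case True
    \<comment> \<open>The loop computes \<open>\<tau>\<^sub>1\<close> before its first test, so \<open>h = 0\<close> must force \<open>S = 0\<close>.\<close>
    then have states: "\<sigma> (h - 1) = 0" "\<tau> (h - 1) = monom 1 t" "\<sigma> h = 1" "\<tau> h = S"
      using eu k(1) by (simp_all add: extended_euclid_def)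
    \<comment> \<open>Case (1) applies to \<sigma>_0 = 1, whose degree 0 must equal |J|.\<close>
    then have "key_equation t S J 1 S"
      using part1 t(2) by simp
    then have "J = {}"
      by (simp add: key_equation_def)
    then have "e = 0"
      by (auto simp: J_def support_def vec_eq_iff)
    then have "S = 0"
      unfolding S_e by (simp add: syndrome_poly_def syndrome_def)
    then show ?thesis
      using euclid_loop_0[OF assms(4)] states by simp
  next
    case False
    have "\<not> degree (\<tau> (int i)) < t div 2" if "i < k" for i
      using h_min k that by force
    then show ?thesis
      using euclid_loop_eq_state[OF eu, of k] False k h_less by simp
  qed

  have decoded: "algorithm_B enum t \<alpha> w f H r = Some (e, c)"
    if enum: "\<forall>A. distinct (enum A) \<and> set (enum A) = A" for enum :: "'a set \<Rightarrow> 'a list"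
  proof (cases "degree (\<sigma> h) < t div 2")
    case True
    then obtain x where x: "x \<noteq> 0" "\<sigma> h = smult x s" "\<tau> h = smult x q"
      using small by blast
    show ?thesis
      using props(3)[OF x] True
      by (simp add: algorithm_B_def loop flip: S) (simp add: r)
  next
    case False
    with deg_le have eq: "degree (\<sigma> h) = t div 2" by simp
    let ?M = "most_frequent (beta \<alpha> (\<sigma> (h - 1)) (\<sigma> h))"
    let ?\<sigma> = "\<lambda>y. smult y (\<sigma> (h - 1)) + \<sigma> h" and ?\<tau> = "\<lambda>y. smult y (\<tau> (h - 1)) + \<tau> h"
    obtain x lam where x: "x \<noteq> 0" "?\<sigma> lam = smult x s" "?\<tau> lam = smult x q" and lam: "lam \<in> ?M"
      using part2[OF eq] by blast
    \<comment> \<open>A passing y need not be \<open>lam\<close>; it suffices that its error values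
      form a word of weight at most t/2 with syndrome polynomial S.\<close>
    have found: "error_values t \<alpha> w (?\<sigma> y) (?\<tau> y) = e"
      if y: "y \<in> ?M" and stop: "tau_decomposition t \<alpha> w f (?\<sigma> y) (?\<tau> y)" for y
    proof -
      let ?\<epsilon> = "error_values t \<alpha> w (?\<sigma> y) (?\<tau> y)"
      have card: "card (root_set \<alpha> (?\<sigma> y)) = t div 2"
        using y most_frequent[OF eq] by simp
      have deg: "degree (?\<sigma> y) = card (root_set \<alpha> (?\<sigma> y))"
        using card deg_comb[OF eq] by simp
      have nz: "?\<sigma> y \<noteq> 0"
        using deg_comb[OF eq, of y] t(2) by auto
      have dvd: "monom 1 t dvd S * \<sigma> (h - 1) - \<tau> (h - 1)" "monom 1 t dvd S * \<sigma> h - \<tau> h"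
        using inv by (auto simp: euclid_inv_def)
      have "S * ?\<sigma> y - ?\<tau> y = smult y (S * \<sigma> (h - 1) - \<tau> (h - 1)) + (S * \<sigma> h - \<tau> h)"
        by (simp add: smult_diff_right algebra_simps)
      then have "monom 1 t dvd S * ?\<sigma> y - ?\<tau> y"
        by (simp only:) (intro dvd_add dvd_smult dvd)
      \<comment> \<open>The test of Step 5 says precisely that \<tau> is the evaluator of \<sigma>
        and the computed error values.\<close>
      moreover have "?\<tau> y = evaluator t \<alpha> w f (?\<sigma> y) ?\<epsilon>"
        using stop by (simp add: tau_decomposition_def evaluator_def Let_def)
      ultimately have "monom 1 t dvd S * ?\<sigma> y - evaluator t \<alpha> w f (?\<sigma> y) ?\<epsilon>"
        by simp
      from evaluator_locator_unique[OF t(1) \<alpha> support_error_values nz deg inj this deg_S]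
      have "S = syndrome_poly t (syndrome H ?\<epsilon>)"
        by (simp add: H)
      moreover have "card (support ?\<epsilon>) \<le> t div 2"
        unfolding card[symmetric] by (intro card_mono support_error_values) simp
      ultimately show ?thesis by (rule word_eq)
    qed
    have "tau_decomposition t \<alpha> w f (?\<sigma> lam) (?\<tau> lam)"
      using props(2)[OF x] by (simp add: locator_condition_def Let_def)
    with lam found enum
    have "try_all (\<lambda>y. error_values t \<alpha> w (?\<sigma> y) (?\<tau> y))
        (\<lambda>y. tau_decomposition t \<alpha> w f (?\<sigma> y) (?\<tau> y)) (enum ?M) None = Some e"
      by (intro try_all_eq_Some[of lam]) auto
    then show ?thesis
      using False by (simp add: algorithm_B_def loop flip: S) (simp add: r)
  qed

  show ?thesis
  proof (intro conjI impI allI)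
    assume "degree (\<sigma> h) < t div 2"
    then show "key_equation t S (support e) (\<sigma> h) (\<tau> h)" "dist_to_code r C < t div 2"
      using part1 by (simp_all add: J_def)
  next
    assume eq: "degree (\<sigma> h) = t div 2"
    from part2[OF eq] obtain x lam where x: "x \<noteq> 0" "smult lam (\<sigma> (h - 1)) + \<sigma> h = smult x s"
        "smult lam (\<tau> (h - 1)) + \<tau> h = smult x q"
      and lam: "lam \<in> most_frequent (beta \<alpha> (\<sigma> (h - 1)) (\<sigma> h))" and card: "card J = t div 2"
      by blast
    show "\<exists>lam.
               key_equation t S (support e)
                 (smult lam (\<sigma> (h - 1)) + \<sigma> h) (smult lam (\<tau> (h - 1)) + \<tau> h) \<and>
               locator_condition t \<alpha> w f
                 (smult lam (\<sigma> (h - 1)) + \<sigma> h) (smult lam (\<tau> (h - 1)) + \<tau> h) \<and>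
               lam \<in> most_frequent (beta \<alpha> (\<sigma> (h - 1)) (\<sigma> h))"
      using props(1,2)[OF x] lam unfolding J_def by blast
    show "dist_to_code r C = t div 2"
      using card dist by simp
  next
    fix enum :: "'a set \<Rightarrow> 'a list"
    assume "\<forall>A. distinct (enum A) \<and> set (enum A) = A"
    then show "algorithm_B enum t \<alpha> w f H r = Some (e, c)"
      by (rule decoded)
  qed
qed

end
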